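(* Let $\mathcal{G}$ be the path graph with one branch on $n$ vertices and let $Y=f^0+\epsilon$ with $f^0\in\mathbb{R}^n$, $\epsilon\sim\mathcal{N}_n(0,\sigma^2I_n)$. Let $S\subseteq\{2,\ldots,n\}$ with $s:=|S|$, and let an admissible decomposition of $\mathcal{G}$ into three path graphs with segment lengths $d^i_j$ be given. Assume that $d^1_1,d^2_{s_2+1},d^3_{s_3+1}\ge4$. Fix $\delta\in(0,1)$, $\gamma>1$, let $\lambda=\gamma\sigma\sqrt{2\log(4(n-s-1)/\delta)/n}$ and $\widehat f:=\arg\min_{f\in\mathbb{R}^n}\{\|Y-f\|_n^2+2\lambda\|Df\|_1\}$. Then, with probability at least $1-\delta$, $$\|\widehat f-f^0\|_n^2\le\inf_{f\in\mathbb{R}^n}\left\{\|f-f^0\|_n^2+4\lambda\|(Df)_{-S}\|_1\right\}+\frac{8\log(2/\delta)\sigma^2}{n}+4\sigma^2\frac{s+1}{n}+8\sigma^2\log(4(n-s-1)/\delta)\left(\frac{2\gamma^2s}{\bar\Delta_h}+\frac{5(2s+3)}{2n}\log\left(\frac{n+1}{2s+3}\right)+\frac{\zeta}{n}\right),$$ where, with $m_1:=b_{s_1+1}$, $m_2:=b_{s_1+2}$, $m_3:=b_{s_1+s_2+3}$ and $b^*=m_1+m_2+m_3$, $$\zeta=\begin{cases}0,&\text{if } m_1,m_2,m_3\ge2,\\ b^*/2,&\text{if } m_2=0\text{ or }m_3=0,\\ 3,&\text{if } m_1=1\text{ and }\min(m_2,m_3)=2,\\ b^*/4,&\text{if } m_1=1\text{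 and }\min(m_2,m_3)\ge3,\\ b^*/4,&\text{if } m_2=1\text{ or }m_3=1.\end{cases}$$ Moreover, choosing $f=f^0$ and $S=S_0$ (with $s_0=|S_0|$) one gets $$\|\widehat f-f^0\|_n^2=\mathcal{O}(\log(n)s_0/\bar\Delta_h)+\mathcal{O}(\log(n)\log(n/s_0)s_0/n)+\mathcal{O}(\log(n)\zeta/n).$$
   Context: For $v\in\mathbb{R}^n$, $\|v\|_1=\sum_i|v_i|$ and $\|v\|_n^2=\frac1n\sum_iv_i^2$. Branched path graph: $n=n_1+n_2$ vertices $1,\ldots,n$; edges $(i-1,i)$ for $2\le i\le n_1$ (main branch), $(b,n_1+1)$ with $1\le b<n_1$, and $(i-1,i)$ for $n_1+2\le i\le n$ (side branch). It is rooted at vertex $1$, each vertex $i\ge2$ has a parent $\mathrm{pa}(i)$ (its neighbour towards the root), and the edge from the parent to $i$ is indexed by $i$. $(Df)_i=f_i-f_{\mathrm{pa}(i)}$, $i=2,\ldots,n$, and $(Df)_{-S}$ is the restriction of $Df$ to indices in $\{2,\ldots,n\}\setminus S$. $S_0=\{i\in\{2,\ldots,n\}:f^0_i\ne f^0_{\mathrm{pa}(i)}\}$. Partition of $S$: $S_1=S\cap\{2,\ldots,b\}=\{i_1<\cdots<i_{s_1}\}$, $S_2=S\cap\{b+1,\ldots,n_1\}=\{j_1<\cdots<j_{s_2}\}$, $S_3=S\cap\{n_1+1,\ldots,n\}=\{k_1<\cdots<k_{s_3}\}$, with $s_i\ge1$. Set $b_{s_1+1}=b-i_{s_1}+1$,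 $b_{s_1+2}=j_1-b-1$, $b_{s_1+s_2+3}=k_1-n_1-1$. Admissible decomposition: by removing two edges not in $S$, the graph is decomposed into three vertex-disjoint path graphs $P^1,P^2,P^3$ covering all vertices, such that $P^i$ contains exactly the edges of $S$ lying in $S_i$; $P^1$ starts at vertex $1$, $P^2$ ends at vertex $n_1$, $P^3$ ends at vertex $n$. (The end of $P^1$ need not be $b$, and the starting points of $P^2,P^3$ need not be $b+1,n_1+1$.) Traversing $P^i$ in this direction, removal of the edges in $S_i$ cuts $P^i$ into $s_i+1$ consecutive segments with $d^i_1,\ldots,d^i_{s_i+1}$ vertices. It is required that $d^i_1\ge2$, $d^i_{s_i+1}\ge2$ and $d^i_j\ge4$ for $2\le j\le s_i$, for every $i$; in particular $b^*=d^1_{s_1+1}+d^2_1+d^3_1\ge6$. $\Delta^i:=(d^i_1,\lfloor d^i_2/2\rfloor,\lceil d^i_2/2\rceil,\ldots,\lfloor d^i_{s_i}/2\rfloor,\lceil d^i_{s_i}/2\rceil,d^i_{s_i+1})\in\mathbb{R}^{2s_i}$, $\Delta:=(\Delta^1,\Delta^2,\Delta^3)\in\mathbb{R}^{2s}$, and $\bar\Delta_h$ is the harmonic mean of $\Delta$. The final rate is understood as $n\to\infty$ with $\sigma,\gamma,\delta$ fixed, on the event of probability at least $1-\delta$, with $S=S_0$ satisfying the stated assumptions. *)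

theory Defs
  imports "HOL-Probability.Probability"
begin

text \<open>
  A vector in \<open>\<real>\<^sup>n\<close> is a function \<open>nat \<Rightarrow> real\<close> read on the indices \<open>{1..n}\<close>;
  \<open>extensional {1..n}\<close> contains exactly one such function per vector.
\<close>

definition norm1 :: "nat set \<Rightarrow> (nat \<Rightarrow> real) \<Rightarrow> real" where
  "norm1 I v = (\<Sum>i\<in>I. \<bar>v i\<bar>)"

definition emp_norm_sq :: "nat \<Rightarrow> (nat \<Rightarrow> real) \<Rightarrow> real" where
  "emp_norm_sq n v = (1 / real n) * (\<Sum>i = 1..n. (v i)\<^sup>2)"


section \<open>The branched path graph\<close>

definition branched_path :: "nat \<Rightarrow> nat \<Rightarrow> nat \<Rightarrow> bool" where
  "branched_path n1 n2 b \<longleftrightarrow> 1 \<le> b \<and> b < n1 \<and> 1 \<le> n2"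

text \<open>Only meaningful for vertices \<open>i \<ge> 2\<close>; the root is vertex \<open>1\<close>.\<close>

definition parent :: "nat \<Rightarrow> nat \<Rightarrow> nat \<Rightarrow> nat" where
  "parent n1 b i = (if i = n1 + 1 then b else i - 1)"

definition edge :: "nat \<Rightarrow> nat \<Rightarrow> nat \<Rightarrow> nat set" where
  "edge n1 b i = {parent n1 b i, i}"

lemma edges_branched_path:
  assumes "branched_path n1 n2 b"
  shows "edge n1 b ` {2..n1 + n2} =
    {{i - 1, i} |i. 2 \<le> i \<and> i \<le> n1} \<union> {{b, n1 + 1}} \<union>
    {{i - 1, i} |i. n1 + 2 \<le> i \<and> i \<le> n1 + n2}"
proof -
  have "{2..n1 + n2} = {2..n1} \<union> {n1 + 1} \<union> {n1 + 2..n1 + n2}"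
    using assms by (auto simp: branched_path_def)
  moreover have "edge n1 b ` {2..n1} = {{i - 1, i} |i. 2 \<le> i \<and> i \<le> n1}"
    by (force simp: edge_def parent_def image_def)
  moreover have "edge n1 b ` {n1 + 2..n1 + n2} =
      {{i - 1, i} |i. n1 + 2 \<le> i \<and> i \<le> n1 + n2}"
    by (force simp: edge_def parent_def image_def)
  moreover have "edge n1 b ` {n1 + 1} = {{b, n1 + 1}}"
    by (simp add: edge_def parent_def)
  ultimately show ?thesis
    by (simp only: image_Un)
qed

definition Dop :: "nat \<Rightarrow> nat \<Rightarrow> (nat \<Rightarrow> real) \<Rightarrow> nat \<Rightarrow> real" where
  "Dop n1 b f i = f i - f (parent n1 b i)"

definition active_set :: "nat \<Rightarrow> nat \<Rightarrow> nat \<Rightarrow> (nat \<Rightarrow> real) \<Rightarrow> nat set" where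
  "active_set n1 n2 b f = {i \<in> {2..n1 + n2}. f i \<noteq> f (parent n1 b i)}"


section \<open>Admissible decompositions into three paths\<close>

text \<open>A path graph is given by its list of vertices, in the direction of traversal.\<close>

definition path_edges :: "nat list \<Rightarrow> nat set set" where
  "path_edges p = {{p ! k, p ! Suc k} |k. Suc k < length p}"

fun segments :: "nat set set \<Rightarrow> nat list \<Rightarrow> nat list list" where
  "segments C [] = []"
| "segments C [v] = [[v]]"
| "segments C (u # v # p) =
     (if {u, v} \<in> C then [u] # segments C (v # p)
      else (u # hd (segments C (v # p))) # tl (segments C (v # p)))"

text \<open>The list \<open>(d\<^sub>1, \<dots>, d\<^sub>s\<^sub>+\<^sub>1)\<close> of a path; the entry \<open>d\<^sub>j\<close> is found at list position \<open>j - 1\<close>.\<close>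

definition seg_lengths :: "nat \<Rightarrow> nat \<Rightarrow> nat set \<Rightarrow> nat list \<Rightarrow> nat list" where
  "seg_lengths n1 b S p = map length (segments (edge n1 b ` S) p)"

definition admissible_lengths :: "nat list \<Rightarrow> bool" where
  "admissible_lengths d \<longleftrightarrow>
     hd d \<ge> 2 \<and> last d \<ge> 2 \<and> (\<forall>j. 1 \<le> j \<and> j < length d - 1 \<longrightarrow> d ! j \<ge> 4)"

definition admissible_decomposition ::
  "nat \<Rightarrow> nat \<Rightarrow> nat \<Rightarrow> nat set \<Rightarrow> nat list \<Rightarrow> nat list \<Rightarrow> nat list \<Rightarrow> bool" where
  "admissible_decomposition n1 n2 b S p1 p2 p3 \<longleftrightarrow>
     p1 \<noteq> [] \<and> p2 \<noteq> [] \<and> p3 \<noteq> [] \<and>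
     distinct (p1 @ p2 @ p3) \<and> set (p1 @ p2 @ p3) = {1..n1 + n2} \<and>
     (\<exists>e e'. e \<noteq> e' \<and> {e, e'} \<subseteq> {2..n1 + n2} - S \<and>
        path_edges p1 \<union> path_edges p2 \<union> path_edges p3 = edge n1 b ` ({2..n1 + n2} - {e, e'})) \<and>
     hd p1 = 1 \<and> last p2 = n1 \<and> last p3 = n1 + n2 \<and>
     path_edges p1 \<inter> edge n1 b ` S = edge n1 b ` (S \<inter> {2..b}) \<and>
     path_edges p2 \<inter> edge n1 b ` S = edge n1 b ` (S \<inter> {b + 1..n1}) \<and>
     path_edges p3 \<inter> edge n1 b ` S = edge n1 b ` (S \<inter> {n1 + 1..n1 + n2}) \<and>
     admissible_lengths (seg_lengths n1 b S p1) \<and>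
     admissible_lengths (seg_lengths n1 b S p2) \<and>
     admissible_lengths (seg_lengths n1 b S p3)"

text \<open>\<open>\<lfloor>d/2\<rfloor>\<close> and \<open>\<lceil>d/2\<rceil>\<close> are \<open>d div 2\<close> and \<open>(d + 1) div 2\<close>.\<close>

definition Delta_part :: "nat list \<Rightarrow> nat list" where
  "Delta_part d =
     [hd d] @ concat (map (\<lambda>k. [k div 2, (k + 1) div 2]) (butlast (tl d))) @ [last d]"

definition Delta ::
  "nat \<Rightarrow> nat \<Rightarrow> nat set \<Rightarrow> nat list \<Rightarrow> nat list \<Rightarrow> nat list \<Rightarrow> nat list" where
  "Delta n1 b S p1 p2 p3 =
     Delta_part (seg_lengths n1 b S p1) @
     Delta_part (seg_lengths n1 b S p2) @
     Delta_part (seg_lengths n1 b S p3)"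

definition harmonic_mean :: "nat list \<Rightarrow> real" where
  "harmonic_mean xs = real (length xs) / (\<Sum>x\<leftarrow>xs. 1 / real x)"

text \<open>
  The arguments are \<open>m\<^sub>1 \<ge> 1\<close> and \<open>m\<^sub>2, m\<^sub>3 \<ge> 0\<close>, so the cases are exhaustive and the last branch
  is the case \<open>m\<^sub>2 = 1 \<or> m\<^sub>3 = 1\<close>. The cases overlap only if one of \<open>m\<^sub>2, m\<^sub>3\<close> is \<open>0\<close> and the other is \<open>1\<close>; then the earlier case, with the larger value, applies.
\<close>

definition zeta_fun :: "nat \<Rightarrow> nat \<Rightarrow> nat \<Rightarrow> real" where
  "zeta_fun m1 m2 m3 =
     (let bstar = real (m1 + m2 + m3) in
      if m1 \<ge> 2 \<and> m2 \<ge> 2 \<and> m3 \<ge> 2 then 0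
      else if m2 = 0 \<or> m3 = 0 then bstar / 2
      else if m1 = 1 \<and> min m2 m3 = 2 then 3
      else if m1 = 1 \<and> min m2 m3 \<ge> 3 then bstar / 4
      else bstar / 4)"

text \<open>
  With \<open>i\<^sub>s\<close> the last index of \<open>S\<^sub>1\<close> and \<open>j\<^sub>1\<close>, \<open>k\<^sub>1\<close> the first indices of \<open>S\<^sub>2\<close>, \<open>S\<^sub>3\<close>:
  \<open>m\<^sub>1 = b - i\<^sub>s + 1\<close>, \<open>m\<^sub>2 = j\<^sub>1 - b - 1\<close>, \<open>m\<^sub>3 = k\<^sub>1 - n\<^sub>1 - 1\<close>. For nonempty parts no subtraction truncates.
\<close>

definition zeta :: "nat \<Rightarrow> nat \<Rightarrow> nat \<Rightarrow> nat set \<Rightarrow> real" where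
  "zeta n1 n2 b S =
     zeta_fun (b - Max (S \<inter> {2..b}) + 1)
              (Min (S \<inter> {b + 1..n1}) - b - 1)
              (Min (S \<inter> {n1 + 1..n1 + n2}) - n1 - 1)"


section \<open>The model and the estimator\<close>

text \<open>The coordinates \<open>eps 1, \<dots>, eps n\<close> form a random vector with law \<open>N\<^sub>n(0, \<sigma>\<^sup>2 I\<^sub>n)\<close>.\<close>

definition gaussian_noise :: "'a measure \<Rightarrow> nat \<Rightarrow> real \<Rightarrow> (nat \<Rightarrow> 'a \<Rightarrow> real) \<Rightarrow> bool" where
  "gaussian_noise M n \<sigma> eps \<longleftrightarrow>
     prob_space M \<and>
     prob_space.indep_vars M (\<lambda>_. borel) eps {1..n} \<and>
     (\<forall>i\<in>{1..n}. distributed M lborel (eps i) (normal_density 0 \<sigma>))"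

definition tuning :: "nat \<Rightarrow> nat \<Rightarrow> real \<Rightarrow> real \<Rightarrow> real \<Rightarrow> real" where
  "tuning n s \<sigma> \<gamma> \<delta> =
     \<gamma> * \<sigma> * sqrt (2 * ln (4 * (real n - real s - 1) / \<delta>) / real n)"

definition tv_estimator ::
  "nat \<Rightarrow> nat \<Rightarrow> nat \<Rightarrow> real \<Rightarrow> (nat \<Rightarrow> real) \<Rightarrow> (nat \<Rightarrow> real)" where
  "tv_estimator n1 n2 b l Y =
     arg_min (\<lambda>f. emp_norm_sq (n1 + n2) (\<lambda>i. Y i - f i) + 2 * l * norm1 {2..n1 + n2} (Dop n1 b f))
             (\<lambda>f. f \<in> extensional {1..n1 + n2})"

end

theory Submission
  imports Defs
begin

text \<open>
  Why the theorem holds. Let \<open>h\<close> be the difference of the estimator and a competitor \<open>f\<close>. Strong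
  convexity of the least squares objective (\<open>tv_basic_inequality\<close>) reduces the claim to a bound, up to
  half the squared norm of \<open>h\<close>, on

    noise against \<open>h\<close>, plus \<open>\<Lambda>\<close> times the variation of \<open>h\<close> on \<open>S\<close>, minus \<open>\<Lambda>\<close> times its variation
    off \<open>S\<close>, where \<open>\<Lambda> = \<lambda> * n\<close>.

  The graph enters only through the decomposition. Removing the edges of \<open>S\<close> from the three paths
  leaves \<open>s + 3\<close> chains that cover all vertices. On each chain the noise is split into its mean and a
  centred part. The means are a projection of the noise onto a space of dimension \<open>s + 3\<close>; their
  squared norm is of chi-square type (\<open>gaussian_block_sums_tail\<close>). Summation by parts writes the
  centred part as a sum over the inner edges of the chain, where the coefficient of the \<open>k\<close>-th
  increment in a chain of \<open>d\<close> vertices is a Gaussian variable of variance at most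
  \<open>\<sigma>\<^sup>2 * min k (d - k)\<close>. On an event of probability at least \<open>1 - \<delta>\<close> (\<open>noise_event\<close>) the penalty
  off \<open>S\<close> absorbs these coefficients and keeps a fraction \<open>w = 1 - r * bridge_sd d k\<close> of itself.

  The remaining fraction pays for the variation on \<open>S\<close>. A flow along the chains with values \<open>\<plusminus>1\<close> on
  \<open>S\<close>, values bounded by \<open>w\<close> elsewhere and value \<open>0\<close> at the ends of the paths turns, again by
  summation by parts, the variation on \<open>S\<close> into a linear functional of \<open>h\<close> whose coefficients are
  the increments of the flow (\<open>chain_bound\<close>, \<open>path_bound\<close>). The flow is a piecewise linear tent times
  \<open>w\<close>. The squared increments of the tents add up to the sum of the reciprocals of the entries of
  \<open>\<Delta>\<close>, which is the harmonic mean term; those of \<open>w\<close> add up to at most a multiple of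
  \<open>2 + ln (d / 2) / 2\<close> per chain (\<open>bridge_roughness_le\<close>), which the concavity of the logarithm
  (\<open>total_roughness_le\<close>) turns into the term with \<open>ln ((n + 1) / (2 * s + 3))\<close>.

  The projection has two dimensions more than the number \<open>s + 1\<close> of components of the graph without
  \<open>S\<close>. This makes the two removed edges free of noise, so that the flow may vanish there and the
  three paths decouple. The constants of the logarithmic term leave room for the two extra dimensions,
  because the length conditions imply \<open>n \<ge> 4 * s + 6\<close> (\<open>remainder_le\<close>).

  The probability concerns a measurable event because the estimator is a nonexpansive, hence
  continuous, function of the data (\<open>is_pls_continuous\<close>).
\<close>

section \<open>Weights on a single chain\<close>

lemma ln_ge_frac:
  fixes x :: real
  assumes "1 \<le> x"
  shows "2 * (x - 1) / (x + 1) \<le> ln x"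
proof -
  let ?f = "\<lambda>y::real. ln y - 2 * (y - 1) / (y + 1)"
  have "?f 1 \<le> ?f x"
  proof (rule DERIV_nonneg_imp_nondecreasing[OF assms])
    fix y :: real
    assume y: "1 \<le> y" "y \<le> x"
    have "(?f has_real_derivative (1 / y - 4 / (y + 1)\<^sup>2)) (at y)"
      using y by (auto intro!: derivative_eq_intros simp: field_simps power2_eq_square)
    moreover have "4 * y \<le> (y + 1)\<^sup>2"
      using zero_le_power2[of "y - 1"] by (simp add: power2_eq_square algebra_simps)
    then have "1 / y - 4 / (y + 1)\<^sup>2 \<ge> 0"
      using y by (simp add: field_simps)
    ultimately show "\<exists>D. (?f has_real_derivative D) (at y) \<and> 0 \<le> D"
      by blast
  qed
  then show ?thesis by simp
qed

text \<open>
  This is the Cauchy-Schwarz inequality for the integral of \<open>1 / (2 * sqrt x)\<close> over \<open>{k..k + 1}\<close>.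
  With \<open>a = sqrt k\<close> and \<open>b = sqrt (k + 1)\<close> the left side is \<open>(b - a) / (b + a)\<close>, because
  \<open>b\<^sup>2 - a\<^sup>2 = 1\<close>, and \<open>ln_ge_frac\<close> at \<open>b / a\<close> finishes the proof.
\<close>

lemma sqrt_increment_sq_le:
  fixes k :: real
  assumes "0 < k"
  shows "(sqrt (k + 1) - sqrt k)\<^sup>2 \<le> (ln (k + 1) - ln k) / 4"
proof -
  define a b where "a = sqrt k" and "b = sqrt (k + 1)"
  have a: "a > 0" "b > a" and sq: "b\<^sup>2 - a\<^sup>2 = 1"
    using assms by (auto simp: a_def b_def)
  have "(b - a)\<^sup>2 * (b + a) = (b - a) * (b\<^sup>2 - a\<^sup>2)"
    by (simp add: power2_eq_square algebra_simps)
  then have "(b - a)\<^sup>2 = (b - a) / (b + a)"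
    using a sq by (simp add: eq_divide_eq)
  also have "\<dots> = ((b - a) / a) / ((b + a) / a)"
    using a by simp
  also have "\<dots> = (b / a - 1) / (b / a + 1)"
    using a by (simp add: diff_divide_distrib add_divide_distrib)
  also have "\<dots> \<le> ln (b / a) / 2"
  proof -
    have "2 * ((b / a - 1) / (b / a + 1)) \<le> ln (b / a)"
      using ln_ge_frac[of "b / a"] a unfolding times_divide_eq_right by simp
    then show ?thesis by linarith
  qed
  also have "\<dots> = (ln (k + 1) - ln k) / 4"
    using assms by (simp add: a_def b_def ln_div ln_sqrt)
  finally show ?thesis by (simp add: a_def b_def)
qed

lemma sum_sqrt_increments_le:
  assumes "1 \<le> m"
  shows "(\<Sum>k<m. (sqrt (real (Suc k)) - sqrt (real k))\<^sup>2) \<le> 1 + ln (real m) / 4"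
  using assms
proof (induction m rule: nat_induct_at_least)
  case (Suc m)
  then show ?case
    using sqrt_increment_sq_le[of "real m"] by (simp add: add.commute)
qed simp

text \<open>
  For \<open>d\<close> independent variables of variance \<open>1\<close>, centred by their mean, the sum of the first \<open>k\<close> has variance
  \<open>k * (d - k) / d\<close>, that of a random walk bridge. The majorant \<open>min k (d - k)\<close> is used instead
  because the increments of its square root are those of \<open>sqrt\<close> itself.
\<close>

definition bridge_sd :: "nat \<Rightarrow> nat \<Rightarrow> real" where
  "bridge_sd d k = sqrt (real (min k (d - k)))"

definition bridge_roughness :: "nat \<Rightarrow> real" where
  "bridge_roughness d = (\<Sum>k<d. (bridge_sd d (Suc k) - bridge_sd d k)\<^sup>2)"

text \<open>
  Up to the midpoint the increments are those of \<open>sqrt\<close>, after it the same ones in reverse; for odd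
  \<open>d\<close> the middle increment is \<open>0\<close>.
\<close>

lemma bridge_roughness_le:
  assumes "2 \<le> d"
  shows "bridge_roughness d \<le> 2 + ln (real (d div 2)) / 2"
proof -
  define m where "m = d div 2"
  define f where "f k = (bridge_sd d (Suc k) - bridge_sd d k)\<^sup>2" for k
  have m: "1 \<le> m" "m \<le> d - m" "d - m \<le> Suc m" "m \<le> d"
    using assms by (auto simp: m_def)
  have "{..<d} = {..<m} \<union> {m..<d - m} \<union> {d - m..<d}"
    using m by auto
  then have "bridge_roughness d = sum f ({..<m} \<union> {m..<d - m} \<union> {d - m..<d})"
    by (simp add: bridge_roughness_def f_def)
  also have "\<dots> = sum f {..<m} + sum f {m..<d - m} + sum f {d - m..<d}"
    by (subst sum.union_disjoint sum.union_disjoint; (use m in force)?)+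
  also have "sum f {m..<d - m} = 0"
  proof (rule sum.neutral, rule)
    fix k assume "k \<in> {m..<d - m}"
    then have "k = m" "d = Suc (2 * m)" using m by auto
    then show "f k = 0" by (simp add: f_def bridge_sd_def)
  qed
  also have "sum f {..<m} = (\<Sum>k<m. (sqrt (real (Suc k)) - sqrt (real k))\<^sup>2)"
    using m by (intro sum.cong) (auto simp: f_def bridge_sd_def min_def)
  also have "sum f {d - m..<d} = (\<Sum>k<m. (sqrt (real (Suc k)) - sqrt (real k))\<^sup>2)"
  proof (rule sum.reindex_bij_witness[where i = "\<lambda>k. d - Suc k" and j = "\<lambda>k. d - Suc k"])
    fix k assume "k \<in> {d - m..<d}"
    then have k: "d - m \<le> k" "k < d" by auto
    then have "min (Suc k) (d - Suc k) = d - Suc k" "min k (d - k) = Suc (d - Suc k)"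
      using m by auto
    then show "(sqrt (real (Suc (d - Suc k))) - sqrt (real (d - Suc k)))\<^sup>2 = f k"
      by (simp add: f_def bridge_sd_def power2_commute)
  qed (use m in auto)
  finally show ?thesis
    using sum_sqrt_increments_le[OF m(1)] by (simp add: m_def)
qed

text \<open>
  The squared increments of an interpolation between two end values of modulus at most \<open>1\<close>, linear
  except that it passes through \<open>0\<close> at the midpoint when both end values are nonzero. The detour
  through \<open>0\<close> makes the cost independent of their signs. The reciprocals are the terms of the
  harmonic mean in the theorem.
\<close>

definition tent_cost :: "real \<Rightarrow> real \<Rightarrow> nat \<Rightarrow> real" where
  "tent_cost u v d =
     (if u = 0 \<or> v = 0 then 1 / real d else 1 / real (d div 2) + 1 / real ((d + 1) div 2))"

lemma tent_exists:
  assumes "\<bar>u\<bar> \<le> 1" "\<bar>v\<bar> \<le> 1" "2 \<le> d"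
  obtains t :: "nat \<Rightarrow> real"
  where "t 0 = u" "t d = v" "\<And>k. k \<le> d \<Longrightarrow> \<bar>t k\<bar> \<le> 1"
    "(\<Sum>k<d. (t (Suc k) - t k)\<^sup>2) \<le> tent_cost u v d"
proof (cases "u = 0 \<or> v = 0")
  case True
  define t where "t k = u + (v - u) * (real k / real d)" for k
  have d: "real d > 0" using assms by simp
  have step: "t (Suc k) - t k = (v - u) / real d" for k
    using d by (simp add: t_def field_simps)
  have "(v - u)\<^sup>2 \<le> 1"
    using True assms by (auto simp: abs_square_le_1)
  then have "(v - u)\<^sup>2 / real d \<le> 1 / real d"
    using d by (intro divide_right_mono) auto
  moreover have "(\<Sum>k<d. (t (Suc k) - t k)\<^sup>2) = (v - u)\<^sup>2 / real d"
    unfolding step using d by (simp add: power_divide power2_eq_square[of "real d"])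
  ultimately have "(\<Sum>k<d. (t (Suc k) - t k)\<^sup>2) \<le> 1 / real d"
    by simp
  moreover have "\<bar>t k\<bar> \<le> 1" if "k \<le> d" for k
  proof -
    define z where "z = real k / real d"
    have z: "0 \<le> z" "z \<le> 1" using that d by (auto simp: z_def)
    consider "u = 0" | "v = 0" using True by blast
    then show ?thesis
    proof cases
      case 1
      then show ?thesis using z assms
        by (simp add: t_def z_def[symmetric] abs_mult mult_le_one)
    next
      case 2
      then have "t k = u * (1 - z)" by (simp add: t_def z_def algebra_simps)
      then show ?thesis using z assms by (simp add: abs_mult mult_le_one)
    qed
  qed
  ultimately show ?thesis
    using True d by (intro that[of t]) (auto simp: t_def tent_cost_def)
next
  case False
  define m m' where "m = d div 2" and "m' = (d + 1) div 2"
  have m: "real m > 0" "real m' > 0" "m + m' = d" using assms by (auto simp: m_def m'_def)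
  define t where "t k = (if k \<le> m then u * (1 - real k / real m)
    else v * (real (k - m) / real m'))" for k
  have "(\<Sum>k<d. (t (Suc k) - t k)\<^sup>2)
      = (\<Sum>k<m. (t (Suc k) - t k)\<^sup>2) + (\<Sum>k=m..<d. (t (Suc k) - t k)\<^sup>2)"
    using m by (subst sum.union_disjoint[symmetric]) (auto intro!: sum.cong)
  also have "(\<Sum>k<m. (t (Suc k) - t k)\<^sup>2) = (\<Sum>k<m. (u / real m)\<^sup>2)"
  proof (rule sum.cong[OF refl])
    fix k assume "k \<in> {..<m}"
    then have "t (Suc k) - t k = - (u / real m)"
      using m by (simp add: t_def field_simps)
    then show "(t (Suc k) - t k)\<^sup>2 = (u / real m)\<^sup>2" by simp
  qed
  also have "(\<Sum>k=m..<d. (t (Suc k) - t k)\<^sup>2) = (\<Sum>k=m..<d. (v / real m')\<^sup>2)"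
  proof (rule sum.cong[OF refl])
    fix k assume "k \<in> {m..<d}"
    then have "t (Suc k) - t k = v / real m'"
      using m by (cases "k = m") (auto simp: t_def field_simps of_nat_diff)
    then show "(t (Suc k) - t k)\<^sup>2 = (v / real m')\<^sup>2" by simp
  qed
  also have "(\<Sum>k=m..<d. (v / real m')\<^sup>2) = v\<^sup>2 / real m'"
  proof -
    have "d - m = m'" using m by simp
    then show ?thesis using m by (simp add: power2_eq_square)
  qed
  also have "(\<Sum>k<m. (u / real m)\<^sup>2) = u\<^sup>2 / real m"
    using m by (simp add: power2_eq_square)
  also have "u\<^sup>2 / real m + v\<^sup>2 / real m' \<le> 1 / real m + 1 / real m'"
    using assms m by (intro add_mono divide_right_mono) (auto simp: abs_square_le_1)
  finally have "(\<Sum>k<d. (t (Suc k) - t k)\<^sup>2) \<le> tent_cost u v d"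
    using False by (simp add: tent_cost_def m_def m'_def)
  moreover have "\<bar>t k\<bar> \<le> 1" if "k \<le> d" for k
  proof (cases "k \<le> m")
    case True
    then have "0 \<le> 1 - real k / real m" "1 - real k / real m \<le> 1" using m by auto
    then show ?thesis using True assms by (simp add: t_def abs_mult mult_le_one)
  next
    case False
    define z where "z = real (k - m) / real m'"
    have z: "0 \<le> z" "z \<le> 1"
      using m that by (auto simp: z_def divide_le_eq)
    have "t k = v * z" using False by (simp add: t_def z_def)
    then show ?thesis using z assms by (simp add: abs_mult mult_le_one)
  qed
  moreover have "t d = v"
    using m by (auto simp: t_def)
  ultimately show ?thesis
    by (intro that[of t]) (auto simp: t_def)
qed

lemma summation_by_parts:
  fixes a x :: "nat \<Rightarrow> real"
  assumes "1 \<le> d"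
  shows "(\<Sum>i<d. (a (Suc i) - a i) * x i)
    = a d * x (d - 1) - a 0 * x 0 - (\<Sum>k=1..<d. a k * (x k - x (k - 1)))"
  using assms
proof (induction d rule: nat_induct_at_least)
  case (Suc d)
  then show ?case
    by (simp add: algebra_simps)
qed (simp add: algebra_simps)

text \<open>
  The core estimate, on one chain. The increments of \<open>x\<close> are paid for at rate \<open>\<Lambda>\<close>.
  Of the payment for the \<open>k\<close>-th increment, the fraction \<open>r * bridge_sd d k\<close> absorbs the centred
  noise; the rest carries a flow \<open>q\<close> from the left end to the right end, with prescribed end values
  \<open>t 0\<close> and \<open>t d\<close>. Summation by parts turns the flow into a linear functional of \<open>x\<close> whose
  coefficients are the increments of \<open>q = t * (1 - r * bridge_sd d)\<close>.
\<close>

lemma chain_bound: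
  fixes x e t :: "nat \<Rightarrow> real"
  assumes d: "1 \<le> d" and \<Lambda>: "0 \<le> \<Lambda>" and r: "0 \<le> r"
    and sd: "\<And>k. k \<le> d \<Longrightarrow> r * bridge_sd d k \<le> 1"
    and t: "\<And>k. k \<le> d \<Longrightarrow> \<bar>t k\<bar> \<le> 1"
    and noise: "\<And>k. 1 \<le> k \<Longrightarrow> k < d \<Longrightarrow>
      \<bar>(\<Sum>i<k. e i) - real k / real d * (\<Sum>i<d. e i)\<bar> \<le> \<Lambda> * (r * bridge_sd d k)"
  shows "(\<Sum>i<d. e i * x i) - \<Lambda> * (\<Sum>k=1..<d. \<bar>x k - x (k - 1)\<bar>)
      + \<Lambda> * (t 0 * x 0 - t d * x (d - 1))
    \<le> (\<Sum>i<d. (x i)\<^sup>2) / 2 + (\<Sum>i<d. e i)\<^sup>2 / real d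
      + 2 * \<Lambda>\<^sup>2 * ((\<Sum>k<d. (t (Suc k) - t k)\<^sup>2) + r\<^sup>2 * bridge_roughness d)"
proof -
  define \<omega> where "\<omega> k = r * bridge_sd d k" for k
  define q where "q k = t k * (1 - \<omega> k)" for k
  define m where "m = (\<Sum>i<d. e i) / real d"
  define V where "V k = (\<Sum>i<k. e i) - real k * m" for k
  define \<rho> where "\<rho> i = q (Suc i) - q i" for i
  let ?D = "\<lambda>k. x k - x (k - 1)"
  have ends: "\<omega> 0 = 0" "\<omega> d = 0" "V 0 = 0" "V d = 0"
    using d by (auto simp: \<omega>_def bridge_sd_def V_def m_def)
  have \<omega>: "0 \<le> \<omega> k" "k \<le> d \<Longrightarrow> \<omega> k \<le> 1" for k
    using r sd by (auto simp: \<omega>_def bridge_sd_def)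
  \<comment> \<open>The noise is its mean plus the increments of the centred partial sums \<open>V\<close>.\<close>
  have "(\<Sum>i<d. e i * x i) = (\<Sum>i<d. m * x i) + (\<Sum>i<d. (V (Suc i) - V i) * x i)"
    unfolding sum.distrib[symmetric] by (intro sum.cong) (auto simp: V_def algebra_simps)
  also have "(\<Sum>i<d. (V (Suc i) - V i) * x i) = (\<Sum>k=1..<d. - (V k * ?D k))"
    using summation_by_parts[OF d, of V x] ends by (simp add: sum_negf)
  also have "\<dots> \<le> (\<Sum>k=1..<d. \<Lambda> * (\<omega> k * \<bar>?D k\<bar>))"
  proof (rule sum_mono)
    fix k assume "k \<in> {1..<d}"
    then have "\<bar>V k\<bar> \<le> \<Lambda> * \<omega> k"
      using noise[of k] by (simp add: V_def m_def \<omega>_def)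
    then have "\<bar>V k\<bar> * \<bar>?D k\<bar> \<le> \<Lambda> * \<omega> k * \<bar>?D k\<bar>"
      by (rule mult_right_mono) simp
    then show "- (V k * ?D k) \<le> \<Lambda> * (\<omega> k * \<bar>?D k\<bar>)"
      using abs_ge_minus_self[of "V k * ?D k"] by (simp add: abs_mult mult.assoc)
  qed
  finally have 1: "(\<Sum>i<d. e i * x i) \<le> (\<Sum>i<d. m * x i) + \<Lambda> * (\<Sum>k=1..<d. \<omega> k * \<bar>?D k\<bar>)"
    by (simp add: sum_distrib_left)
  have "t 0 * x 0 - t d * x (d - 1) = - (\<Sum>i<d. \<rho> i * x i) + (\<Sum>k=1..<d. - (q k * ?D k))"
    using summation_by_parts[OF d, of q x] ends by (simp add: q_def \<rho>_def sum_negf)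
  also have "(\<Sum>k=1..<d. - (q k * ?D k)) \<le> (\<Sum>k=1..<d. (1 - \<omega> k) * \<bar>?D k\<bar>)"
  proof (rule sum_mono)
    fix k assume "k \<in> {1..<d}"
    then have "\<bar>q k\<bar> \<le> 1 - \<omega> k"
      using t[of k] \<omega>(2)[of k] by (simp add: q_def abs_mult mult_left_le_one_le)
    then have "\<bar>q k\<bar> * \<bar>?D k\<bar> \<le> (1 - \<omega> k) * \<bar>?D k\<bar>"
      by (rule mult_right_mono) simp
    then show "- (q k * ?D k) \<le> (1 - \<omega> k) * \<bar>?D k\<bar>"
      using abs_ge_minus_self[of "q k * ?D k"] by (simp add: abs_mult)
  qed
  finally have "\<Lambda> * (t 0 * x 0 - t d * x (d - 1))
      \<le> \<Lambda> * (- (\<Sum>i<d. \<rho> i * x i) + (\<Sum>k=1..<d. (1 - \<omega> k) * \<bar>?D k\<bar>))"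
    using \<Lambda> by (intro mult_left_mono) auto
  also have "(\<Sum>k=1..<d. (1 - \<omega> k) * \<bar>?D k\<bar>)
      = (\<Sum>k=1..<d. \<bar>?D k\<bar>) - (\<Sum>k=1..<d. \<omega> k * \<bar>?D k\<bar>)"
    by (simp add: algebra_simps sum_subtractf)
  finally have "(\<Sum>i<d. e i * x i) - \<Lambda> * (\<Sum>k=1..<d. \<bar>?D k\<bar>) + \<Lambda> * (t 0 * x 0 - t d * x (d - 1))
      \<le> (\<Sum>i<d. m * x i) - \<Lambda> * (\<Sum>i<d. \<rho> i * x i)"
    using 1 by (simp add: algebra_simps)
  also have "\<dots> = (\<Sum>i<d. (m - \<Lambda> * \<rho> i) * x i)"
    by (simp add: sum_distrib_left sum_subtractf algebra_simps)
  also have "\<dots> \<le> (\<Sum>i<d. (x i)\<^sup>2 / 2 + m\<^sup>2 + \<Lambda>\<^sup>2 * (\<rho> i)\<^sup>2)"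
  proof (rule sum_mono)
    fix i
    \<comment> \<open>Young's inequality, followed by \<open>(m - y)\<^sup>2 \<le> 2 * m\<^sup>2 + 2 * y\<^sup>2\<close>.\<close>
    have "0 \<le> (m - \<Lambda> * \<rho> i - x i)\<^sup>2 + (m + \<Lambda> * \<rho> i)\<^sup>2" by simp
    then show "(m - \<Lambda> * \<rho> i) * x i \<le> (x i)\<^sup>2 / 2 + m\<^sup>2 + \<Lambda>\<^sup>2 * (\<rho> i)\<^sup>2"
      by (simp add: power2_eq_square algebra_simps)
  qed
  also have "\<dots> = (\<Sum>i<d. (x i)\<^sup>2) / 2 + real d * m\<^sup>2 + \<Lambda>\<^sup>2 * (\<Sum>i<d. (\<rho> i)\<^sup>2)"
    by (simp add: sum.distrib sum_distrib_left sum_divide_distrib)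
  also have "real d * m\<^sup>2 = (\<Sum>i<d. e i)\<^sup>2 / real d"
    using d by (simp add: m_def power2_eq_square)
  also have "(\<Sum>i<d. (\<rho> i)\<^sup>2)
      \<le> (\<Sum>i<d. 2 * (t (Suc i) - t i)\<^sup>2 + 2 * (r\<^sup>2 * (bridge_sd d (Suc i) - bridge_sd d i)\<^sup>2))"
  proof (rule sum_mono)
    fix i assume "i \<in> {..<d}"
    then have i: "i < d" by simp
    \<comment> \<open>Product rule for \<open>q = t * (1 - \<omega>)\<close>; both factors have modulus at most \<open>1\<close>.\<close>
    define A B where "A = (1 - \<omega> (Suc i)) * (t (Suc i) - t i)"
      and "B = t i * (\<omega> i - \<omega> (Suc i))"
    have "(\<rho> i)\<^sup>2 = (A + B)\<^sup>2"
      by (simp add: \<rho>_def q_def A_def B_def algebra_simps)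
    moreover have "(A + B)\<^sup>2 \<le> 2 * A\<^sup>2 + 2 * B\<^sup>2"
      using zero_le_power2[of "A - B"] by (simp add: power2_eq_square algebra_simps)
    moreover have "\<bar>A\<bar> \<le> \<bar>t (Suc i) - t i\<bar>"
      using \<omega>(1)[of "Suc i"] \<omega>(2)[of "Suc i"] i by (simp add: A_def abs_mult mult_left_le_one_le)
    then have "A\<^sup>2 \<le> (t (Suc i) - t i)\<^sup>2"
      by (simp add: abs_le_square_iff)
    moreover have "\<bar>B\<bar> \<le> \<bar>\<omega> i - \<omega> (Suc i)\<bar>"
      using t[of i] i by (simp add: B_def abs_mult mult_left_le_one_le)
    then have "B\<^sup>2 \<le> (\<omega> i - \<omega> (Suc i))\<^sup>2"
      by (simp add: abs_le_square_iff)
    moreover have "(\<omega> i - \<omega> (Suc i))\<^sup>2 = r\<^sup>2 * (bridge_sd d (Suc i) - bridge_sd d i)\<^sup>2"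
      by (simp add: \<omega>_def power2_eq_square algebra_simps)
    ultimately show "(\<rho> i)\<^sup>2 \<le> 2 * (t (Suc i) - t i)\<^sup>2
        + 2 * (r\<^sup>2 * (bridge_sd d (Suc i) - bridge_sd d i)\<^sup>2)"
      by linarith
  qed
  also have "\<dots> = 2 * ((\<Sum>k<d. (t (Suc k) - t k)\<^sup>2) + r\<^sup>2 * bridge_roughness d)"
    by (simp add: sum.distrib sum_distrib_left bridge_roughness_def algebra_simps)
  finally show ?thesis
    by (simp add: mult_right_mono mult_left_mono algebra_simps)
qed


section \<open>Gluing chains along a path\<close>

definition inner_variation :: "(nat \<Rightarrow> real) \<Rightarrow> nat list \<Rightarrow> real" where
  "inner_variation h g = (\<Sum>k=1..<length g. \<bar>h (g ! k) - h (g ! (k - 1))\<bar>)"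

fun cut_variation :: "(nat \<Rightarrow> real) \<Rightarrow> nat list list \<Rightarrow> real" where
  "cut_variation h (g # g' # gs) = \<bar>h (hd g') - h (last g)\<bar> + cut_variation h (g' # gs)"
| "cut_variation h gs = 0"

text \<open>
  The sum of the tent costs when a flow enters the first chain with value \<open>\<plusminus>1\<close>, takes a value \<open>\<plusminus>1\<close>
  at each cut, and leaves the last chain with value \<open>0\<close>.
\<close>

fun tail_cost :: "nat list \<Rightarrow> real" where
  "tail_cost [] = 0"
| "tail_cost [d] = 1 / real d"
| "tail_cost (d # d' # ds) =
     1 / real (d div 2) + 1 / real ((d + 1) div 2) + tail_cost (d' # ds)"

definition centred_partial_sum :: "(nat \<Rightarrow> real) \<Rightarrow> nat list \<Rightarrow> nat \<Rightarrow> real" where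
  "centred_partial_sum e g k =
     (\<Sum>i<k. e (g ! i)) - real k / real (length g) * (\<Sum>v\<leftarrow>g. e v)"

definition noise_small :: "real \<Rightarrow> (nat \<Rightarrow> real) \<Rightarrow> nat list \<Rightarrow> bool" where
  "noise_small c e g \<longleftrightarrow>
     (\<forall>k. 1 \<le> k \<and> k < length g \<longrightarrow> \<bar>centred_partial_sum e g k\<bar> \<le> c * bridge_sd (length g) k)"

text \<open>
  The part of \<open>chain_bound\<close> that is additive over chains, apart from the boundary terms and the
  weights.
\<close>

definition chain_excess :: "real \<Rightarrow> (nat \<Rightarrow> real) \<Rightarrow> (nat \<Rightarrow> real) \<Rightarrow> nat list \<Rightarrow> real" where
  "chain_excess \<Lambda> e h g =
     (\<Sum>v\<leftarrow>g. e v * h v) - \<Lambda> * inner_variation h g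
       - (\<Sum>v\<leftarrow>g. (h v)\<^sup>2) / 2 - (\<Sum>v\<leftarrow>g. e v)\<^sup>2 / real (length g)"

lemma chain_excess_le:
  assumes g: "2 \<le> length g" and \<Lambda>: "0 \<le> \<Lambda>" and r: "0 \<le> r"
    and sd: "\<And>k. k \<le> length g \<Longrightarrow> r * bridge_sd (length g) k \<le> 1"
    and uv: "\<bar>u\<bar> \<le> 1" "\<bar>v\<bar> \<le> 1"
    and noise: "noise_small (\<Lambda> * r) e g"
  shows "chain_excess \<Lambda> e h g + \<Lambda> * (u * h (hd g) - v * h (last g))
    \<le> 2 * \<Lambda>\<^sup>2 * (tent_cost u v (length g) + r\<^sup>2 * bridge_roughness (length g))"
proof -
  let ?d = "length g"
  obtain t where t: "t 0 = u" "t ?d = v" "\<And>k. k \<le> ?d \<Longrightarrow> \<bar>t k\<bar> \<le> 1"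
    and cost: "(\<Sum>k<?d. (t (Suc k) - t k)\<^sup>2) \<le> tent_cost u v ?d"
    using tent_exists[OF uv g] by blast
  have nonempty: "g \<noteq> []" using g by auto
  have list: "(\<Sum>v\<leftarrow>g. f v) = (\<Sum>i<?d. f (g ! i))" for f :: "nat \<Rightarrow> real"
    by (simp add: sum_list_sum_nth atLeast0LessThan)
  have "(\<Sum>i<?d. e (g ! i) * h (g ! i)) - \<Lambda> * (\<Sum>k=1..<?d. \<bar>h (g ! k) - h (g ! (k - 1))\<bar>)
      + \<Lambda> * (t 0 * h (g ! 0) - t ?d * h (g ! (?d - 1)))
    \<le> (\<Sum>i<?d. (h (g ! i))\<^sup>2) / 2 + (\<Sum>i<?d. e (g ! i))\<^sup>2 / real ?d
      + 2 * \<Lambda>\<^sup>2 * ((\<Sum>k<?d. (t (Suc k) - t k)\<^sup>2) + r\<^sup>2 * bridge_roughness ?d)"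
    using g \<Lambda> r sd t(3) noise
    by (intro chain_bound)
       (auto simp: noise_small_def centred_partial_sum_def list mult.assoc)
  also have "\<dots> \<le> (\<Sum>i<?d. (h (g ! i))\<^sup>2) / 2 + (\<Sum>i<?d. e (g ! i))\<^sup>2 / real ?d
      + 2 * \<Lambda>\<^sup>2 * (tent_cost u v ?d + r\<^sup>2 * bridge_roughness ?d)"
    using cost by (intro add_left_mono mult_left_mono add_right_mono) auto
  finally show ?thesis
    using t nonempty
    by (simp add: chain_excess_def inner_variation_def list hd_conv_nth last_conv_nth)
qed

text \<open>
  Across a cut the flow takes the value \<open>\<plusminus>1\<close>, with the sign for which the boundary terms of the two
  adjacent chains cancel the variation at the cut.
\<close>

lemma glued_chains_le:
  assumes \<Lambda>: "0 \<le> \<Lambda>" and r: "0 \<le> r"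
    and "gs \<noteq> []" "\<And>g. g \<in> set gs \<Longrightarrow> 2 \<le> length g"
    and "\<And>g k. g \<in> set gs \<Longrightarrow> k \<le> length g \<Longrightarrow> r * bridge_sd (length g) k \<le> 1"
    and "\<And>g. g \<in> set gs \<Longrightarrow> noise_small (\<Lambda> * r) e g"
    and "\<bar>u\<bar> = 1"
  shows "(\<Sum>g\<leftarrow>gs. chain_excess \<Lambda> e h g) + \<Lambda> * cut_variation h gs + \<Lambda> * (u * h (hd (hd gs)))
    \<le> 2 * \<Lambda>\<^sup>2 * (tail_cost (map length gs) + r\<^sup>2 * (\<Sum>g\<leftarrow>gs. bridge_roughness (length g)))"
  using assms(3-)
proof (induction gs arbitrary: u rule: induct_list012)
  case (2 g)
  then show ?case
    using chain_excess_le[OF _ \<Lambda> r, of g u 0 e h] by (simp add: tent_cost_def)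
next
  case (3 g g' gs)
  define v :: real where "v = (if h (last g) \<le> h (hd g') then 1 else - 1)"
  have v: "\<bar>v\<bar> = 1" and cut: "v * (h (hd g') - h (last g)) = \<bar>h (hd g') - h (last g)\<bar>"
    by (auto simp: v_def)
  have "chain_excess \<Lambda> e h g + \<Lambda> * (u * h (hd g) - v * h (last g))
      \<le> 2 * \<Lambda>\<^sup>2 * (tent_cost u v (length g) + r\<^sup>2 * bridge_roughness (length g))"
    using 3 v by (intro chain_excess_le \<Lambda> r) auto
  moreover have "tent_cost u v (length g)
      = 1 / real (length g div 2) + 1 / real ((length g + 1) div 2)"
    using v 3 by (auto simp: tent_cost_def)
  moreover have "(\<Sum>g\<leftarrow>g' # gs. chain_excess \<Lambda> e h g) + \<Lambda> * cut_variation h (g' # gs)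
        + \<Lambda> * (v * h (hd (hd (g' # gs))))
      \<le> 2 * \<Lambda>\<^sup>2 * (tail_cost (map length (g' # gs))
        + r\<^sup>2 * (\<Sum>g\<leftarrow>g' # gs. bridge_roughness (length g)))"
    using 3 v by (intro "3.IH") auto
  moreover have "\<Lambda> * \<bar>h (hd g') - h (last g)\<bar> = \<Lambda> * (v * h (hd g')) - \<Lambda> * (v * h (last g))"
    unfolding cut[symmetric] by (simp add: algebra_simps)
  ultimately show ?case
    by (simp add: algebra_simps)
qed simp

text \<open>
  A whole path: the flow starts with value \<open>0\<close>, so the first chain costs only one reciprocal. The
  boundary terms at the outer ends vanish, and those at the cuts have paid for the variation there.
\<close>

lemma path_bound:
  assumes \<Lambda>: "0 \<le> \<Lambda>" and r: "0 \<le> r"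
    and gs: "gs \<noteq> []" and len: "\<And>g'. g' \<in> set (g # gs) \<Longrightarrow> 2 \<le> length g'"
    and sd: "\<And>g' k. g' \<in> set (g # gs) \<Longrightarrow> k \<le> length g' \<Longrightarrow> r * bridge_sd (length g') k \<le> 1"
    and noise: "\<And>g'. g' \<in> set (g # gs) \<Longrightarrow> noise_small (\<Lambda> * r) e g'"
  shows "(\<Sum>g\<leftarrow>g # gs. chain_excess \<Lambda> e h g) + \<Lambda> * cut_variation h (g # gs)
    \<le> 2 * \<Lambda>\<^sup>2 * (1 / real (length g) + tail_cost (map length gs)
        + r\<^sup>2 * (\<Sum>g\<leftarrow>g # gs. bridge_roughness (length g)))"
proof -
  obtain g' gs' where gs': "gs = g' # gs'" using gs by (cases gs) auto
  define v :: real where "v = (if h (last g) \<le> h (hd g') then 1 else - 1)"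
  have v: "\<bar>v\<bar> = 1" and cut: "v * (h (hd g') - h (last g)) = \<bar>h (hd g') - h (last g)\<bar>"
    by (auto simp: v_def)
  have "chain_excess \<Lambda> e h g + \<Lambda> * (0 * h (hd g) - v * h (last g))
      \<le> 2 * \<Lambda>\<^sup>2 * (tent_cost 0 v (length g) + r\<^sup>2 * bridge_roughness (length g))"
    using assms v by (intro chain_excess_le \<Lambda> r) auto
  moreover have "(\<Sum>g\<leftarrow>gs. chain_excess \<Lambda> e h g) + \<Lambda> * cut_variation h gs
        + \<Lambda> * (v * h (hd (hd gs)))
      \<le> 2 * \<Lambda>\<^sup>2 * (tail_cost (map length gs) + r\<^sup>2 * (\<Sum>g\<leftarrow>gs. bridge_roughness (length g)))"
    using assms v by (intro glued_chains_le) auto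
  moreover have "\<Lambda> * \<bar>h (hd g') - h (last g)\<bar> = \<Lambda> * (v * h (hd g')) - \<Lambda> * (v * h (last g))"
    unfolding cut[symmetric] by (simp add: algebra_simps)
  ultimately show ?thesis
    by (simp add: gs' tent_cost_def algebra_simps)
qed


section \<open>The segments of a path\<close>

text \<open>
  The increment as a function of the undirected edge, so that it can be summed both over the tree
  edges and over the steps of a path, whichever way the path traverses them.
\<close>

definition edge_diff :: "(nat \<Rightarrow> real) \<Rightarrow> nat set \<Rightarrow> real" where
  "edge_diff h E = \<bar>h (Max E) - h (Min E)\<bar>"

lemma edge_diff_pair: "edge_diff h {u, v} = \<bar>h u - h v\<bar>"
  by (cases "u \<le> v") (auto simp: edge_diff_def max_def min_def)

lemma path_edges_simps [simp]:
  "path_edges [] = {}" "path_edges [v] = {}"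
  "path_edges (u # v # p) = insert {u, v} (path_edges (v # p))"
proof -
  show "path_edges (u # v # p) = insert {u, v} (path_edges (v # p))" (is "?L = ?R")
  proof (intro equalityI subsetI)
    fix E assume "E \<in> ?L"
    then obtain k where k: "E = {(u # v # p) ! k, (u # v # p) ! Suc k}" "Suc k < length (u # v # p)"
      by (auto simp: path_edges_def)
    then show "E \<in> ?R"
      by (cases k) (auto simp: path_edges_def)
  next
    fix E assume "E \<in> ?R"
    then consider "E = {u, v}"
      | k where "E = {(v # p) ! k, (v # p) ! Suc k}" "Suc k < length (v # p)"
      by (auto simp: path_edges_def)
    then show "E \<in> ?L"
    proof cases
      case 1
      then show ?thesis by (auto simp: path_edges_def intro!: exI[of _ 0])
    next
      case (2 k)
      then show ?thesis by (auto simp: path_edges_def intro!: exI[of _ "Suc k"])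
    qed
  qed
qed (auto simp: path_edges_def)

lemma path_edges_subset: "E \<in> path_edges p \<Longrightarrow> E \<subseteq> set p \<and> E \<noteq> {}"
  by (auto simp: path_edges_def)

lemma finite_path_edges [simp]: "finite (path_edges p)"
  by (induction p rule: induct_list012) auto

lemma segments_neq_Nil_iff [simp]: "segments C p = [] \<longleftrightarrow> p = []"
  by (induction C p rule: segments.induct) auto

lemma segments_nonempty: "[] \<notin> set (segments C p)"
  by (induction C p rule: segments.induct) (auto dest: list.set_sel(2)[rotated])

lemma concat_segments [simp]: "concat (segments C p) = p"
proof (induction C p rule: segments.induct)
  case (3 C u v p)
  then show ?case
    by (cases "segments C (v # p)") auto
qed auto

lemma hd_hd_segments: "p \<noteq> [] \<Longrightarrow> hd (hd (segments C p)) = hd p"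
  using concat_segments[of C p] segments_nonempty[of C p]
  by (cases "segments C p") (auto simp del: concat_segments simp: hd_append)

lemma new_edge_notin_path_edges: "distinct (u # v # p) \<Longrightarrow> {u, v} \<notin> path_edges (v # p)"
  using path_edges_subset by fastforce

lemma length_segments:
  assumes "distinct p" "p \<noteq> []"
  shows "length (segments C p) = Suc (card (path_edges p \<inter> C))"
  using assms
proof (induction C p rule: segments.induct)
  case (3 C u v p)
  have "{u, v} \<notin> path_edges (v # p)"
    using "3.prems" by (intro new_edge_notin_path_edges) auto
  then show ?case
    using 3 by (cases "segments C (v # p)") (auto simp: Int_insert_left)
qed auto

text \<open>The segments account for every edge of the path: the edges in \<open>C\<close> are the cuts.\<close>

lemma cut_variation_segments:
  assumes "distinct p"
  shows "cut_variation h (segments C p) = (\<Sum>E\<in>path_edges p \<inter> C. edge_diff h E)"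
  using assms
proof (induction C p rule: segments.induct)
  case (3 C u v p)
  have new: "{u, v} \<notin> path_edges (v # p)"
    using "3.prems" by (intro new_edge_notin_path_edges) auto
  obtain g gs where gs: "segments C (v # p) = g # gs"
    by (cases "segments C (v # p)") auto
  have "g \<noteq> []" using segments_nonempty[of C "v # p"] gs by auto
  moreover have "hd g = v" using hd_hd_segments[of "v # p" C] gs by simp
  ultimately show ?case
    using 3 new gs
    by (cases gs) (auto simp: Int_insert_left edge_diff_pair abs_minus_commute)
qed auto

lemma inner_variation_Cons:
  assumes "g \<noteq> []"
  shows "inner_variation h (u # g) = \<bar>h u - h (hd g)\<bar> + inner_variation h g"
proof -
  have "inner_variation h (u # g)
      = (\<Sum>k=0..<length g. \<bar>h ((u # g) ! Suc k) - h ((u # g) ! k)\<bar>)"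
    unfolding inner_variation_def
    by (rule sum.reindex_bij_witness[where i = Suc and j = "\<lambda>k. k - 1"]) auto
  also have "\<dots> = \<bar>h (hd g) - h u\<bar> + (\<Sum>k=1..<length g. \<bar>h ((u # g) ! Suc k) - h ((u # g) ! k)\<bar>)"
    using assms by (subst sum.atLeast_Suc_lessThan) (auto simp: hd_conv_nth)
  also have "(\<Sum>k=1..<length g. \<bar>h ((u # g) ! Suc k) - h ((u # g) ! k)\<bar>) = inner_variation h g"
    unfolding inner_variation_def by (intro sum.cong) (auto simp: nth_Cons')
  finally show ?thesis by (simp add: abs_minus_commute)
qed

lemma inner_variation_segments:
  assumes "distinct p"
  shows "(\<Sum>g\<leftarrow>segments C p. inner_variation h g) = (\<Sum>E\<in>path_edges p - C. edge_diff h E)"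
  using assms
proof (induction C p rule: segments.induct)
  case (2 C v)
  then show ?case by (simp add: inner_variation_def)
next
  case (3 C u v p)
  have new: "{u, v} \<notin> path_edges (v # p)"
    using "3.prems" by (intro new_edge_notin_path_edges) auto
  obtain g gs where gs: "segments C (v # p) = g # gs"
    by (cases "segments C (v # p)") auto
  have "g \<noteq> []" using segments_nonempty[of C "v # p"] gs by auto
  moreover have "hd g = v" using hd_hd_segments[of "v # p" C] gs by simp
  ultimately show ?case
    using 3 new gs inner_variation_Cons[of g h u]
    by (auto simp: insert_Diff_if edge_diff_pair inner_variation_def[of h "[u]"])
qed auto


section \<open>Gaussian deviations\<close>

lemma nn_integral_normal_density:
  assumes "0 < \<sigma>"
  shows "(\<integral>\<^sup>+x. ennreal (normal_density \<mu> \<sigma> x) \<partial>lborel) = 1"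
  using assms by (simp add: nn_integral_eq_integral)

lemma normal_density_times_exp_linear:
  assumes "0 < \<sigma>"
  shows "normal_density 0 \<sigma> x * exp (\<tau> * x)
    = exp (\<tau>\<^sup>2 * \<sigma>\<^sup>2 / 2) * normal_density (\<tau> * \<sigma>\<^sup>2) \<sigma> x"
proof -
  have "- x\<^sup>2 / (2 * \<sigma>\<^sup>2) + \<tau> * x = \<tau>\<^sup>2 * \<sigma>\<^sup>2 / 2 + - (x - \<tau> * \<sigma>\<^sup>2)\<^sup>2 / (2 * \<sigma>\<^sup>2)"
    using assms by (simp add: field_simps power2_eq_square)
  then have "exp (- x\<^sup>2 / (2 * \<sigma>\<^sup>2)) * exp (\<tau> * x)
      = exp (\<tau>\<^sup>2 * \<sigma>\<^sup>2 / 2) * exp (- (x - \<tau> * \<sigma>\<^sup>2)\<^sup>2 / (2 * \<sigma>\<^sup>2))"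
    unfolding exp_add[symmetric] by simp
  then show ?thesis
    by (simp add: normal_density_def)
qed

lemma normal_density_times_exp_square:
  assumes "0 < \<sigma>"
  shows "normal_density 0 \<sigma> x * exp (x\<^sup>2 / (4 * \<sigma>\<^sup>2))
    = sqrt 2 * normal_density 0 (sqrt 2 * \<sigma>) x"
proof -
  have "- x\<^sup>2 / (2 * \<sigma>\<^sup>2) + x\<^sup>2 / (4 * \<sigma>\<^sup>2) = - x\<^sup>2 / (2 * (sqrt 2 * \<sigma>)\<^sup>2)"
    using assms by (simp add: field_simps power_mult_distrib)
  then have "exp (- x\<^sup>2 / (2 * \<sigma>\<^sup>2)) * exp (x\<^sup>2 / (4 * \<sigma>\<^sup>2)) = exp (- x\<^sup>2 / (2 * (sqrt 2 * \<sigma>)\<^sup>2))"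
    unfolding exp_add[symmetric] by simp
  moreover have "1 / sqrt (2 * pi * \<sigma>\<^sup>2) = sqrt 2 * (1 / sqrt (2 * pi * (sqrt 2 * \<sigma>)\<^sup>2))"
    using assms by (simp add: power_mult_distrib real_sqrt_mult field_simps)
  ultimately show ?thesis
    by (simp add: normal_density_def)
qed

lemma (in prob_space) gaussian_exp_linear:
  assumes "0 < \<sigma>" and X: "distributed M lborel X (normal_density 0 \<sigma>)"
  shows "(\<integral>\<^sup>+\<omega>. ennreal (exp (\<tau> * X \<omega>)) \<partial>M) = ennreal (exp (\<tau>\<^sup>2 * \<sigma>\<^sup>2 / 2))"
proof -
  have "(\<integral>\<^sup>+\<omega>. ennreal (exp (\<tau> * X \<omega>)) \<partial>M)
      = (\<integral>\<^sup>+x. ennreal (normal_density 0 \<sigma> x) * ennreal (exp (\<tau> * x)) \<partial>lborel)"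
    by (rule distributed_nn_integral[OF X, symmetric]) simp
  also have "\<dots> = (\<integral>\<^sup>+x. ennreal (exp (\<tau>\<^sup>2 * \<sigma>\<^sup>2 / 2))
      * ennreal (normal_density (\<tau> * \<sigma>\<^sup>2) \<sigma> x) \<partial>lborel)"
    by (simp add: ennreal_mult[symmetric] normal_density_times_exp_linear[OF assms(1)])
  finally show ?thesis
    by (simp add: nn_integral_cmult nn_integral_normal_density[OF assms(1)])
qed

lemma (in prob_space) gaussian_exp_square:
  assumes "0 < \<sigma>" and X: "distributed M lborel X (normal_density 0 \<sigma>)"
  shows "(\<integral>\<^sup>+\<omega>. ennreal (exp ((X \<omega>)\<^sup>2 / (4 * \<sigma>\<^sup>2))) \<partial>M) = ennreal (sqrt 2)"
proof -
  have "(\<integral>\<^sup>+\<omega>. ennreal (exp ((X \<omega>)\<^sup>2 / (4 * \<sigma>\<^sup>2))) \<partial>M)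
      = (\<integral>\<^sup>+x. ennreal (normal_density 0 \<sigma> x) * ennreal (exp (x\<^sup>2 / (4 * \<sigma>\<^sup>2))) \<partial>lborel)"
    by (rule distributed_nn_integral[OF X, symmetric]) simp
  also have "\<dots> = (\<integral>\<^sup>+x. ennreal (sqrt 2) * ennreal (normal_density 0 (sqrt 2 * \<sigma>) x) \<partial>lborel)"
    by (simp add: ennreal_mult[symmetric] normal_density_times_exp_square[OF assms(1)])
  finally show ?thesis
    using assms(1) by (simp add: nn_integral_cmult nn_integral_normal_density)
qed

text \<open>
  Chernoff's bound at the optimal exponent \<open>\<tau> = a / (\<sigma>\<^sup>2 * m)\<close>. Only an upper bound \<open>m\<close> on the squared
  norm of the coefficients enters.
\<close>

lemma (in prob_space) gaussian_linear_upper_tail: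
  fixes c :: "'i \<Rightarrow> real" and X :: "'i \<Rightarrow> 'a \<Rightarrow> real"
  assumes \<sigma>: "0 < \<sigma>" and I: "finite I" and ind: "indep_vars (\<lambda>_. borel) X I"
    and X: "\<And>i. i \<in> I \<Longrightarrow> distributed M lborel (X i) (normal_density 0 \<sigma>)"
    and m: "(\<Sum>i\<in>I. (c i)\<^sup>2) \<le> m" "0 < m" and L: "0 < L"
  shows "prob {\<omega> \<in> space M. \<sigma> * sqrt (2 * L) * sqrt m \<le> (\<Sum>i\<in>I. c i * X i \<omega>)} \<le> exp (- L)"
proof -
  define a where "a = \<sigma> * sqrt (2 * L) * sqrt m"
  define \<tau> where "\<tau> = a / (\<sigma>\<^sup>2 * m)"
  define W where "W \<omega> = (\<Sum>i\<in>I. c i * X i \<omega>)" for \<omega>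
  have rv [measurable]: "i \<in> I \<Longrightarrow> X i \<in> borel_measurable M" for i
    using ind by (auto simp: indep_vars_def)
  have W [measurable]: "W \<in> borel_measurable M"
    unfolding W_def by measurable
  have \<tau>: "0 < \<tau>" using \<sigma> m L by (simp add: \<tau>_def a_def)
  have a2: "a\<^sup>2 = \<sigma>\<^sup>2 * (2 * L) * m" using m L by (simp add: a_def power_mult_distrib)
  have ind': "indep_vars (\<lambda>_. borel) (\<lambda>i \<omega>. ennreal (exp (\<tau> * c i * X i \<omega>))) I"
    by (rule indep_vars_compose2[OF ind]) auto
  have "(\<integral>\<^sup>+\<omega>. ennreal (exp (\<tau> * W \<omega>)) \<partial>M) = (\<integral>\<^sup>+\<omega>. (\<Prod>i\<in>I. ennreal (exp (\<tau> * c i * X i \<omega>))) \<partial>M)"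
    using I by (intro nn_integral_cong) (simp add: W_def sum_distrib_left exp_sum prod_ennreal mult.assoc)
  also have "\<dots> = (\<Prod>i\<in>I. \<integral>\<^sup>+\<omega>. ennreal (exp (\<tau> * c i * X i \<omega>)) \<partial>M)"
    by (rule indep_vars_nn_integral[OF I ind']) auto
  also have "\<dots> = (\<Prod>i\<in>I. ennreal (exp ((\<tau> * c i)\<^sup>2 * \<sigma>\<^sup>2 / 2)))"
    using gaussian_exp_linear[OF \<sigma> X] by (intro prod.cong) auto
  also have "\<dots> = ennreal (exp (\<tau>\<^sup>2 * \<sigma>\<^sup>2 / 2 * (\<Sum>i\<in>I. (c i)\<^sup>2)))"
    using I by (simp add: prod_ennreal exp_sum[symmetric] sum_distrib_left power_mult_distrib
        algebra_simps)
  also have "\<dots> \<le> ennreal (exp (\<tau>\<^sup>2 * \<sigma>\<^sup>2 / 2 * m))"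
    using m by (intro ennreal_leI) (simp add: mult_left_mono)
  finally have mgf: "(\<integral>\<^sup>+\<omega>. ennreal (exp (\<tau> * W \<omega>)) \<partial>M) \<le> ennreal (exp (\<tau>\<^sup>2 * \<sigma>\<^sup>2 / 2 * m))" .
  have "emeasure M {\<omega> \<in> space M. a \<le> W \<omega>}
      \<le> ennreal (exp (- \<tau> * a)) * (\<integral>\<^sup>+\<omega>. ennreal (exp (\<tau> * W \<omega>)) * indicator (space M) \<omega> \<partial>M)"
    by (rule Chernoff_ineq_nn_integral_ge[OF \<tau>]) auto
  also have "(\<integral>\<^sup>+\<omega>. ennreal (exp (\<tau> * W \<omega>)) * indicator (space M) \<omega> \<partial>M)
      = (\<integral>\<^sup>+\<omega>. ennreal (exp (\<tau> * W \<omega>)) \<partial>M)"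
    by (intro nn_integral_cong) auto
  also have "ennreal (exp (- \<tau> * a)) * \<dots>
      \<le> ennreal (exp (- \<tau> * a)) * ennreal (exp (\<tau>\<^sup>2 * \<sigma>\<^sup>2 / 2 * m))"
    by (intro mult_left_mono mgf) auto
  also have "\<dots> = ennreal (exp (- L))"
  proof -
    have "\<tau> * a = 2 * L"
      using \<sigma> m a2 by (simp add: \<tau>_def power2_eq_square field_simps)
    moreover have "\<tau>\<^sup>2 * \<sigma>\<^sup>2 / 2 * m = \<tau> * a / 2"
      using \<sigma> m by (simp add: \<tau>_def power2_eq_square field_simps)
    ultimately show ?thesis
      by (simp add: ennreal_mult[symmetric] exp_add[symmetric])
  qed
  finally show ?thesis
    by (simp add: emeasure_eq_measure a_def W_def)
qed

lemma (in prob_space) gaussian_linear_tail: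
  fixes c :: "'i \<Rightarrow> real" and X :: "'i \<Rightarrow> 'a \<Rightarrow> real"
  assumes \<sigma>: "0 < \<sigma>" and I: "finite I" and ind: "indep_vars (\<lambda>_. borel) X I"
    and X: "\<And>i. i \<in> I \<Longrightarrow> distributed M lborel (X i) (normal_density 0 \<sigma>)"
    and m: "(\<Sum>i\<in>I. (c i)\<^sup>2) \<le> m" "0 < m" and L: "0 < L"
  shows "prob {\<omega> \<in> space M. \<sigma> * sqrt (2 * L) * sqrt m < \<bar>\<Sum>i\<in>I. c i * X i \<omega>\<bar>} \<le> 2 * exp (- L)"
proof -
  let ?a = "\<sigma> * sqrt (2 * L) * sqrt m"
  let ?A = "\<lambda>c. {\<omega> \<in> space M. ?a \<le> (\<Sum>i\<in>I. c i * X i \<omega>)}"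
  have [measurable]: "i \<in> I \<Longrightarrow> X i \<in> borel_measurable M" for i
    using ind by (auto simp: indep_vars_def)
  have "prob {\<omega> \<in> space M. ?a < \<bar>\<Sum>i\<in>I. c i * X i \<omega>\<bar>} \<le> prob (?A c \<union> ?A (\<lambda>i. - c i))"
    by (intro finite_measure_mono) (auto simp: sum_negf abs_if split: if_splits)
  also have "\<dots> \<le> prob (?A c) + prob (?A (\<lambda>i. - c i))"
    by (intro measure_Un_le) auto
  also have "\<dots> \<le> exp (- L) + exp (- L)"
    using m by (intro add_mono gaussian_linear_upper_tail[OF \<sigma> I ind X _ _ L]) auto
  finally show ?thesis by simp
qed

text \<open>
  The left side is \<open>\<sigma>\<^sup>2\<close> times a chi-square variable with \<open>card J\<close> degrees of freedom, since normalised
  block sums are independent standard Gaussians. A standard Gaussian \<open>Z\<close> satisfies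
  \<open>E (exp (Z\<^sup>2 / 4)) = sqrt 2\<close>, so Chernoff's bound at the single exponent \<open>1/4\<close> gives the constants
  \<open>4\<close> and \<open>2 * ln 2\<close>.
\<close>

lemma (in prob_space) gaussian_block_sums_tail:
  fixes X :: "'i \<Rightarrow> 'a \<Rightarrow> real" and K :: "'j \<Rightarrow> 'i set"
  assumes \<sigma>: "0 < \<sigma>" and ind: "indep_vars (\<lambda>_. borel) X I"
    and X: "\<And>i. i \<in> I \<Longrightarrow> distributed M lborel (X i) (normal_density 0 \<sigma>)"
    and J: "finite J" and K: "\<And>j. j \<in> J \<Longrightarrow> finite (K j) \<and> K j \<noteq> {} \<and> K j \<subseteq> I"
    and disj: "disjoint_family_on K J"
  shows "prob {\<omega> \<in> space M. \<sigma>\<^sup>2 * (4 * t + 2 * ln 2 * real (card J))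
      \<le> (\<Sum>j\<in>J. (\<Sum>i\<in>K j. X i \<omega>)\<^sup>2 / real (card (K j)))} \<le> exp (- t)"
proof -
  define Z where "Z j \<omega> = (\<Sum>i\<in>K j. X i \<omega>)" for j \<omega>
  define sd where "sd j = \<sigma> * sqrt (real (card (K j)))" for j
  define W where "W \<omega> = (\<Sum>j\<in>J. (Z j \<omega>)\<^sup>2 / real (card (K j)))" for \<omega>
  define s where "s = 1 / (4 * \<sigma>\<^sup>2)"
  have rv: "i \<in> I \<Longrightarrow> X i \<in> borel_measurable M" for i
    using ind by (auto simp: indep_vars_def)
  have sd: "0 < sd j" if "j \<in> J" for j
    using K[OF that] \<sigma> by (simp add: sd_def card_gt_0_iff)
  have normal: "distributed M lborel (Z j) (normal_density 0 (sd j))" if j: "j \<in> J" for j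
  proof -
    have "distributed M lborel (\<lambda>\<omega>. \<Sum>i\<in>K j. X i \<omega>)
        (normal_density (\<Sum>i\<in>K j. 0) (sqrt (\<Sum>i\<in>K j. \<sigma>\<^sup>2)))"
      using K[OF j] \<sigma> X by (intro sum_indep_normal indep_vars_subset[OF ind]) auto
    then show ?thesis
      using \<sigma> by (simp add: Z_def[abs_def] sd_def real_sqrt_mult mult.commute)
  qed
  have Z [measurable]: "j \<in> J \<Longrightarrow> Z j \<in> borel_measurable M" for j
    using distributed_measurable[OF normal] by simp
  have W [measurable]: "W \<in> borel_measurable M"
    unfolding W_def by measurable
  have "indep_vars (\<lambda>j. PiM (K j) (\<lambda>_. borel)) (\<lambda>j \<omega>. restrict (\<lambda>i. X i \<omega>) (K j)) J"
    using K by (intro indep_vars_restrict[OF ind _ disj]) auto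
  then have "indep_vars (\<lambda>_. borel)
      (\<lambda>j \<omega>. ennreal (exp ((\<Sum>i\<in>K j. restrict (\<lambda>i. X i \<omega>) (K j) i)\<^sup>2 / (4 * (sd j)\<^sup>2)))) J"
    by (rule indep_vars_compose2) measurable
  then have indZ: "indep_vars (\<lambda>_. borel) (\<lambda>j \<omega>. ennreal (exp ((Z j \<omega>)\<^sup>2 / (4 * (sd j)\<^sup>2)))) J"
    by (simp add: Z_def)
  have "s * ((Z j \<omega>)\<^sup>2 / real (card (K j))) = (Z j \<omega>)\<^sup>2 / (4 * (sd j)\<^sup>2)" for j \<omega>
    by (simp add: s_def sd_def power_mult_distrib)
  then have "(\<integral>\<^sup>+\<omega>. ennreal (exp (s * W \<omega>)) \<partial>M)
      = (\<integral>\<^sup>+\<omega>. (\<Prod>j\<in>J. ennreal (exp ((Z j \<omega>)\<^sup>2 / (4 * (sd j)\<^sup>2)))) \<partial>M)"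
    using J by (intro nn_integral_cong) (simp add: W_def sum_distrib_left exp_sum prod_ennreal)
  also have "\<dots> = (\<Prod>j\<in>J. \<integral>\<^sup>+\<omega>. ennreal (exp ((Z j \<omega>)\<^sup>2 / (4 * (sd j)\<^sup>2))) \<partial>M)"
    by (rule indep_vars_nn_integral[OF J indZ]) auto
  also have "\<dots> = (\<Prod>j\<in>J. ennreal (sqrt 2))"
    using gaussian_exp_square[OF sd normal] by (intro prod.cong) auto
  also have "\<dots> = ennreal (exp (ln 2 / 2 * real (card J)))"
  proof -
    have "sqrt 2 = exp (ln 2 / 2)"
      by (simp add: ln_sqrt[symmetric])
    then have "sqrt 2 ^ card J = exp (ln 2 / 2 * real (card J))"
      by (simp add: exp_of_nat_mult[symmetric] mult.commute)
    then show ?thesis by (simp add: ennreal_power)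
  qed
  finally have mgf: "(\<integral>\<^sup>+\<omega>. ennreal (exp (s * W \<omega>)) \<partial>M) = ennreal (exp (ln 2 / 2 * real (card J)))" .
  define a where "a = \<sigma>\<^sup>2 * (4 * t + 2 * ln 2 * real (card J))"
  have "emeasure M {\<omega> \<in> space M. a \<le> W \<omega>}
      \<le> ennreal (exp (- s * a)) * (\<integral>\<^sup>+\<omega>. ennreal (exp (s * W \<omega>)) * indicator (space M) \<omega> \<partial>M)"
    using \<sigma> by (intro Chernoff_ineq_nn_integral_ge) (auto simp: s_def)
  also have "(\<integral>\<^sup>+\<omega>. ennreal (exp (s * W \<omega>)) * indicator (space M) \<omega> \<partial>M)
      = ennreal (exp (ln 2 / 2 * real (card J)))"
    unfolding mgf[symmetric] by (intro nn_integral_cong) auto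
  also have "ennreal (exp (- s * a)) * \<dots> = ennreal (exp (- t))"
  proof -
    have "s * a = t + ln 2 / 2 * real (card J)"
      using \<sigma> by (simp add: s_def a_def field_simps)
    then show ?thesis
      by (simp add: ennreal_mult[symmetric] exp_add[symmetric])
  qed
  finally show ?thesis
    by (simp add: emeasure_eq_measure a_def W_def Z_def)
qed


section \<open>Penalised least squares\<close>

definition pls_objective ::
  "nat set \<Rightarrow> real \<Rightarrow> ((nat \<Rightarrow> real) \<Rightarrow> real) \<Rightarrow> (nat \<Rightarrow> real) \<Rightarrow> (nat \<Rightarrow> real) \<Rightarrow> real" where
  "pls_objective I c pen Y f = c * (\<Sum>i\<in>I. (Y i - f i)\<^sup>2) + pen f"

definition is_pls ::
  "nat set \<Rightarrow> real \<Rightarrow> ((nat \<Rightarrow> real) \<Rightarrow> real) \<Rightarrow> (nat \<Rightarrow> real) \<Rightarrow> (nat \<Rightarrow> real) \<Rightarrow> bool" where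
  "is_pls I c pen Y =
     is_arg_min (pls_objective I c pen Y) (\<lambda>f. f \<in> extensional I)"

text \<open>
  Outside a box around \<open>Y\<close> the quadratic term alone exceeds the objective at \<open>0\<close>; the box is
  compact in the product topology.
\<close>

lemma is_pls_exists:
  assumes I: "finite I" and c: "0 < c"
    and pen: "continuous_on UNIV pen" "\<And>f. 0 \<le> pen f"
  obtains f where "is_pls I c pen Y f"
proof -
  let ?obj = "pls_objective I c pen Y"
  define z where "z = restrict (\<lambda>_. 0 :: real) I"
  define B where "B = sqrt (?obj z / c)"
  define box where "box = PiE UNIV (\<lambda>i. if i \<in> I then {Y i - B..Y i + B} else {undefined :: real})"
  have box_iff: "f \<in> box \<longleftrightarrow> f \<in> extensional I \<and> (\<forall>i\<in>I. \<bar>Y i - f i\<bar> \<le> B)" for f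
    by (auto simp: box_def PiE_def Pi_def extensional_def abs_le_iff split: if_splits)
  have obj_nonneg: "0 \<le> ?obj f" for f
    using c pen(2) by (auto simp: pls_objective_def intro!: add_nonneg_nonneg mult_nonneg_nonneg sum_nonneg)
  have small: "f \<in> box" if f: "f \<in> extensional I" "?obj f \<le> ?obj z" for f
  proof -
    have "\<bar>Y i - f i\<bar> \<le> B" if i: "i \<in> I" for i
    proof -
      have "(Y i - f i)\<^sup>2 \<le> (\<Sum>i\<in>I. (Y i - f i)\<^sup>2)"
        using I i by (intro member_le_sum) auto
      then have "c * (Y i - f i)\<^sup>2 \<le> ?obj f"
        using c pen(2)[of f] unfolding pls_objective_def
        by (smt (verit) mult_left_mono)
      then have "(Y i - f i)\<^sup>2 \<le> ?obj z / c"
        using f c by (simp add: field_simps)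
      then show ?thesis
        unfolding B_def by (rule real_le_rsqrt[of "\<bar>Y i - f i\<bar>", simplified])
    qed
    with f show ?thesis by (simp add: box_iff)
  qed
  have "compactin (product_topology (\<lambda>_. euclidean) UNIV) box"
    unfolding box_def compactin_PiE by auto
  then have "compact box"
    by (simp add: euclidean_product_topology)
  moreover have "z \<in> box"
    by (rule small) (auto simp: z_def)
  moreover have "continuous_on box ?obj"
  proof -
    have "continuous_on UNIV (\<lambda>f::nat \<Rightarrow> real. f i)" for i
      by (rule continuous_on_product_coordinates)
    then have "continuous_on UNIV ?obj"
      unfolding pls_objective_def by (intro continuous_intros pen(1)) auto
    then show ?thesis by (rule continuous_on_subset) auto
  qed
  ultimately obtain f where f: "f \<in> box" "\<And>g. g \<in> box \<Longrightarrow> ?obj f \<le> ?obj g"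
    using continuous_attains_inf[of box ?obj] by blast
  have "?obj f \<le> ?obj g" if g: "g \<in> extensional I" for g
  proof (cases "?obj g \<le> ?obj z")
    case True
    then show ?thesis using small g f by blast
  next
    case False
    then show ?thesis using f(2)[OF \<open>z \<in> box\<close>] by simp
  qed
  then have "is_pls I c pen Y f"
    using f(1) by (auto simp: is_pls_def is_arg_min_linorder box_iff)
  then show ?thesis by (rule that)
qed

text \<open>Strong convexity, tested on the segment from \<open>f\<close> to \<open>g\<close> near \<open>f\<close>.\<close>

lemma is_pls_growth:
  assumes c: "0 < c" and f: "is_pls I c pen Y f" and g: "g \<in> extensional I"
    and conv: "\<And>f g \<tau>. 0 \<le> \<tau> \<Longrightarrow> \<tau> \<le> 1 \<Longrightarrow>
      pen (restrict (\<lambda>i. (1 - \<tau>) * f i + \<tau> * g i) I) \<le> (1 - \<tau>) * pen f + \<tau> * pen g"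
  shows "pls_objective I c pen Y f + c * (\<Sum>i\<in>I. (g i - f i)\<^sup>2) \<le> pls_objective I c pen Y g"
proof -
  let ?obj = "pls_objective I c pen Y"
  define Q where "Q = (\<Sum>i\<in>I. (g i - f i)\<^sup>2)"
  have key: "?obj f + (1 - \<tau>) * (c * Q) \<le> ?obj g" if \<tau>: "0 < \<tau>" "\<tau> \<le> 1" for \<tau>
  proof -
    define h where "h = restrict (\<lambda>i. (1 - \<tau>) * f i + \<tau> * g i) I"
    have "?obj f \<le> ?obj h"
      using f by (auto simp: is_pls_def is_arg_min_linorder h_def)
    also have "\<dots> = c * (\<Sum>i\<in>I. (1 - \<tau>) * (Y i - f i)\<^sup>2 + \<tau> * (Y i - g i)\<^sup>2
        - \<tau> * (1 - \<tau>) * (g i - f i)\<^sup>2) + pen h"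
      unfolding pls_objective_def
      by (intro arg_cong2[of _ _ _ _ "(+)"] arg_cong2[of _ _ _ _ "(*)"] sum.cong refl)
         (auto simp: h_def power2_eq_square algebra_simps)
    also have "\<dots> = c * ((1 - \<tau>) * (\<Sum>i\<in>I. (Y i - f i)\<^sup>2) + \<tau> * (\<Sum>i\<in>I. (Y i - g i)\<^sup>2)
        - \<tau> * (1 - \<tau>) * Q) + pen h"
      by (simp only: Q_def sum.distrib sum_subtractf sum_distrib_left)
    also have "\<dots> \<le> c * ((1 - \<tau>) * (\<Sum>i\<in>I. (Y i - f i)\<^sup>2) + \<tau> * (\<Sum>i\<in>I. (Y i - g i)\<^sup>2)
        - \<tau> * (1 - \<tau>) * Q) + ((1 - \<tau>) * pen f + \<tau> * pen g)"
      using conv[of \<tau> f g] \<tau> by (simp add: h_def)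
    also have "\<dots> = ?obj f + \<tau> * (?obj g - ?obj f - (1 - \<tau>) * (c * Q))"
      by (simp add: pls_objective_def algebra_simps)
    finally have "0 \<le> \<tau> * (?obj g - ?obj f - (1 - \<tau>) * (c * Q))" by simp
    then show ?thesis using \<tau> by (simp add: zero_le_mult_iff)
  qed
  have "((\<lambda>\<tau>. ?obj f + (1 - \<tau>) * (c * Q)) \<longlongrightarrow> ?obj f + (1 - 0) * (c * Q)) (at_right 0)"
    by (intro tendsto_intros)
  then have "?obj f + (1 - 0) * (c * Q) \<le> ?obj g"
  proof (rule tendsto_upperbound)
    show "\<forall>\<^sub>F \<tau> in at_right 0. ?obj f + (1 - \<tau>) * (c * Q) \<le> ?obj g"
      unfolding eventually_at_right_field by (intro exI[of _ 1]) (auto intro: key)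
  qed simp
  then show ?thesis by (simp add: Q_def)
qed

text \<open>
  Adding the growth inequalities at the two minimisers cancels the penalties and leaves
  \<open>\<bar>f - g\<bar>\<^sup>2 \<le> \<langle>Y - Y', f - g\<rangle>\<close>.
\<close>

lemma is_pls_nonexpansive:
  assumes c: "0 < c" and I: "finite I"
    and f: "is_pls I c pen Y f" and g: "is_pls I c pen Y' g"
    and conv: "\<And>f g \<tau>. 0 \<le> \<tau> \<Longrightarrow> \<tau> \<le> 1 \<Longrightarrow>
      pen (restrict (\<lambda>i. (1 - \<tau>) * f i + \<tau> * g i) I) \<le> (1 - \<tau>) * pen f + \<tau> * pen g"
  shows "(\<Sum>i\<in>I. (f i - g i)\<^sup>2) \<le> (\<Sum>i\<in>I. (Y i - Y' i)\<^sup>2)"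
proof -
  have ext: "f \<in> extensional I" "g \<in> extensional I"
    using f g by (auto simp: is_pls_def is_arg_min_linorder)
  have "c * (\<Sum>i\<in>I. (Y i - f i)\<^sup>2) + c * (\<Sum>i\<in>I. (g i - f i)\<^sup>2)
      + (c * (\<Sum>i\<in>I. (Y' i - g i)\<^sup>2) + c * (\<Sum>i\<in>I. (f i - g i)\<^sup>2))
    \<le> c * (\<Sum>i\<in>I. (Y i - g i)\<^sup>2) + c * (\<Sum>i\<in>I. (Y' i - f i)\<^sup>2)"
    using is_pls_growth[OF c f ext(2) conv] is_pls_growth[OF c g ext(1) conv]
    by (simp add: pls_objective_def)
  then have "c * (\<Sum>i\<in>I. (Y i - f i)\<^sup>2 + (g i - f i)\<^sup>2 + (Y' i - g i)\<^sup>2 + (f i - g i)\<^sup>2)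
      \<le> c * (\<Sum>i\<in>I. (Y i - g i)\<^sup>2 + (Y' i - f i)\<^sup>2)"
    by (simp add: sum.distrib algebra_simps)
  then have "0 \<le> (\<Sum>i\<in>I. (Y i - g i)\<^sup>2 + (Y' i - f i)\<^sup>2)
      - (\<Sum>i\<in>I. (Y i - f i)\<^sup>2 + (g i - f i)\<^sup>2 + (Y' i - g i)\<^sup>2 + (f i - g i)\<^sup>2)"
    using c by simp
  also have "\<dots> = (\<Sum>i\<in>I. 2 * ((Y i - Y' i) * (f i - g i)) - 2 * (f i - g i)\<^sup>2)"
    unfolding sum_subtractf[symmetric]
    by (intro sum.cong) (auto simp: power2_eq_square algebra_simps)
  also have "\<dots> \<le> (\<Sum>i\<in>I. (Y i - Y' i)\<^sup>2 - (f i - g i)\<^sup>2)"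
  proof (rule sum_mono)
    fix i
    have "0 \<le> ((Y i - Y' i) - (f i - g i))\<^sup>2" by simp
    then show "2 * ((Y i - Y' i) * (f i - g i)) - 2 * (f i - g i)\<^sup>2 \<le> (Y i - Y' i)\<^sup>2 - (f i - g i)\<^sup>2"
      by (simp add: power2_eq_square algebra_simps)
  qed
  finally show ?thesis by (simp add: sum_subtractf)
qed

text \<open>
  Continuity in the product topology makes the estimator a measurable function of the data; without
  measurability the probability in the theorem would not be meaningful.
\<close>

lemma is_pls_continuous:
  assumes c: "0 < c" and I: "finite I"
    and F: "\<And>Y. is_pls I c pen Y (F Y)"
    and conv: "\<And>f g \<tau>. 0 \<le> \<tau> \<Longrightarrow> \<tau> \<le> 1 \<Longrightarrow>
      pen (restrict (\<lambda>i. (1 - \<tau>) * f i + \<tau> * g i) I) \<le> (1 - \<tau>) * pen f + \<tau> * pen g"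
    and i: "i \<in> I"
  shows "continuous_on UNIV (\<lambda>Y. F Y i)"
  unfolding continuous_on_def
proof
  fix Y :: "nat \<Rightarrow> real"
  have bound: "\<bar>F Y' i - F Y i\<bar> \<le> sqrt (\<Sum>i\<in>I. (Y' i - Y i)\<^sup>2)" for Y'
  proof -
    have "(F Y' i - F Y i)\<^sup>2 \<le> (\<Sum>i\<in>I. (F Y' i - F Y i)\<^sup>2)"
      using I i by (intro member_le_sum) auto
    also have "\<dots> \<le> (\<Sum>i\<in>I. (Y' i - Y i)\<^sup>2)"
      by (rule is_pls_nonexpansive[OF c I F F conv])
    finally show ?thesis
      by (rule real_le_rsqrt[of "\<bar>F Y' i - F Y i\<bar>", simplified])
  qed
  have "continuous_on UNIV (\<lambda>f::nat \<Rightarrow> real. f i)" for i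
    by (rule continuous_on_product_coordinates)
  then have "continuous_on UNIV (\<lambda>Y'. sqrt (\<Sum>i\<in>I. (Y' i - Y i)\<^sup>2))"
    by (intro continuous_intros) auto
  then have "((\<lambda>Y'. sqrt (\<Sum>i\<in>I. (Y' i - Y i)\<^sup>2)) \<longlongrightarrow> 0) (at Y)"
    unfolding continuous_on_def by (auto dest!: spec[of _ Y])
  then have "((\<lambda>Y'. F Y' i - F Y i) \<longlongrightarrow> 0) (at Y)"
    by (rule Lim_null_comparison[rotated]) (simp add: bound)
  then show "((\<lambda>Y'. F Y' i) \<longlongrightarrow> F Y i) (at Y within UNIV)"
    by (simp add: LIM_zero_iff)
qed


section \<open>The noise event\<close>

lemma distinct_concat_nth_disjoint:
  assumes "distinct (concat gs)" "i < length gs" "j < length gs" "i \<noteq> j"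
  shows "set (gs ! i) \<inter> set (gs ! j) = {}"
  using assms
proof (induction gs arbitrary: i j)
  case (Cons g gs)
  have "set g \<inter> set (gs ! k) = {}" if "k < length gs" for k
    using Cons.prems(1) nth_mem[OF that] by auto
  moreover have "set (gs ! k) \<inter> set (gs ! k') = {}"
    if "k < length gs" "k' < length gs" "k \<noteq> k'" for k k'
    using Cons that by auto
  ultimately show ?case
    using Cons.prems by (cases i; cases j) (auto simp: Int_commute)
qed simp

text \<open>
  A centred partial sum is a linear form with coefficients \<open>1 - k/d\<close> (\<open>k\<close> times) and
  \<open>- k/d\<close> (\<open>d - k\<close> times), whose squares add up to \<open>k * (d - k) / d\<close>.
\<close>

lemma centred_partial_sum_linear:
  assumes g: "distinct g" and k: "k < length g"
  obtains c where "\<And>e. centred_partial_sum e g k = (\<Sum>v\<in>set g. c v * e v)"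
    "(\<Sum>v\<in>set g. (c v)\<^sup>2) \<le> (bridge_sd (length g) k)\<^sup>2"
proof -
  let ?d = "length g"
  define A where "A = set (take k g)"
  define B where "B = set (drop k g)"
  define z where "z = real k / real ?d"
  define c where "c v = (if v \<in> A then 1 - z else - z)" for v
  have d: "real ?d > 0" and kd: "k \<le> ?d" using k by linarith+
  have zb: "0 \<le> z" "z \<le> 1" and zk: "real k = z * real ?d"
    using kd d by (auto simp: z_def divide_le_eq)
  have AB: "set g = A \<union> B" "A \<inter> B = {}" "finite A" "finite B" "card A = k" "card B = ?d - k"
    using g kd set_append[of "take k g" "drop k g"] set_take_disj_set_drop_if_distinct[OF g, of k k]
    by (auto simp: A_def B_def distinct_card)
  have "centred_partial_sum e g k = (\<Sum>v\<in>set g. c v * e v)" for e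
  proof -
    have "(\<Sum>i<k. e (g ! i)) = (\<Sum>v\<leftarrow>take k g. e v)"
      using kd by (simp add: sum_list_sum_nth atLeast0LessThan min_def)
    also have "\<dots> = (\<Sum>v\<in>A. e v)"
      using g by (simp add: A_def sum_list_distinct_conv_sum_set)
    finally have "centred_partial_sum e g k = (\<Sum>v\<in>A. e v) - z * (\<Sum>v\<in>set g. e v)"
      using g by (simp add: centred_partial_sum_def z_def sum_list_distinct_conv_sum_set)
    also have "\<dots> = (\<Sum>v\<in>A. (1 - z) * e v) + (\<Sum>v\<in>B. - z * e v)"
      using AB by (simp add: sum.union_disjoint sum_distrib_left sum_subtractf sum_negf algebra_simps)
    also have "\<dots> = (\<Sum>v\<in>A. c v * e v) + (\<Sum>v\<in>B. c v * e v)"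
      using AB by (intro arg_cong2[of _ _ _ _ "(+)"] sum.cong) (auto simp: c_def)
    finally show ?thesis
      using AB by (simp add: sum.union_disjoint)
  qed
  moreover have "(\<Sum>v\<in>set g. (c v)\<^sup>2) \<le> (bridge_sd ?d k)\<^sup>2"
  proof -
    have "(\<Sum>v\<in>set g. (c v)\<^sup>2) = (\<Sum>v\<in>A. (c v)\<^sup>2) + (\<Sum>v\<in>B. (c v)\<^sup>2)"
      using AB by (simp add: sum.union_disjoint)
    also have "\<dots> = (\<Sum>v\<in>A. (1 - z)\<^sup>2) + (\<Sum>v\<in>B. z\<^sup>2)"
      using AB by (intro arg_cong2[of _ _ _ _ "(+)"] sum.cong) (auto simp: c_def)
    also have "\<dots> = real k * (1 - z)\<^sup>2 + (real ?d - real k) * z\<^sup>2"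
      using AB kd by (simp add: of_nat_diff)
    also have "\<dots> = real ?d * z * (1 - z)"
      unfolding zk by (simp add: power2_eq_square algebra_simps)
    finally have eq: "(\<Sum>v\<in>set g. (c v)\<^sup>2) = real ?d * z * (1 - z)" .
    have "real ?d * z * (1 - z) \<le> real ?d * z"
      using zb d by (intro mult_left_le) auto
    moreover have "z * (real ?d * (1 - z)) \<le> 1 * (real ?d * (1 - z))"
      using zb d by (intro mult_right_mono) auto
    ultimately have "real ?d * z * (1 - z) \<le> min (real k) (real ?d - real k)"
      unfolding zk by (simp add: algebra_simps)
    then show ?thesis
      using eq kd by (simp add: bridge_sd_def min_def of_nat_diff split: if_splits)
  qed
  ultimately show ?thesis by (rule that)
qed

text \<open>
  A union bound over the inner edges of all chains, as many as there are vertices minus chains, and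
  over the event that the chain means are large.
\<close>

lemma (in prob_space) noise_event:
  fixes \<epsilon> :: "nat \<Rightarrow> 'a \<Rightarrow> real"
  assumes \<sigma>: "0 < \<sigma>" and ind: "indep_vars (\<lambda>_. borel) \<epsilon> I"
    and normal: "\<And>i. i \<in> I \<Longrightarrow> distributed M lborel (\<epsilon> i) (normal_density 0 \<sigma>)"
    and gs: "distinct (concat gs)" "set (concat gs) \<subseteq> I" "[] \<notin> set gs" and L: "0 < L"
  obtains G where "G \<in> events"
    "1 - (2 * (real (length (concat gs)) - real (length gs)) * exp (- L) + exp (- t)) \<le> prob G"
    "\<And>\<omega> g. \<omega> \<in> G \<Longrightarrow> g \<in> set gs \<Longrightarrow> noise_small (\<sigma> * sqrt (2 * L)) (\<lambda>i. \<epsilon> i \<omega>) g"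
    "\<And>\<omega>. \<omega> \<in> G \<Longrightarrow> (\<Sum>g\<leftarrow>gs. (\<Sum>v\<leftarrow>g. \<epsilon> v \<omega>)\<^sup>2 / real (length g))
      \<le> \<sigma>\<^sup>2 * (4 * t + 2 * ln 2 * real (length gs))"
proof -
  let ?N = "length gs"
  define bad where "bad p = {\<omega> \<in> space M. \<sigma> * sqrt (2 * L) * bridge_sd (length (gs ! fst p)) (snd p)
    < \<bar>centred_partial_sum (\<lambda>i. \<epsilon> i \<omega>) (gs ! fst p) (snd p)\<bar>}" for p
  define idx where "idx = Sigma {..<?N} (\<lambda>j. {1..<length (gs ! j)})"
  define large where "large = {\<omega> \<in> space M. \<sigma>\<^sup>2 * (4 * t + 2 * ln 2 * real (card {..<?N}))
      \<le> (\<Sum>j<?N. (\<Sum>i\<in>set (gs ! j). \<epsilon> i \<omega>)\<^sup>2 / real (card (set (gs ! j))))}"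
  define G where "G = space M - (large \<union> (\<Union>p\<in>idx. bad p))"
  have block: "gs ! j \<noteq> []" "set (gs ! j) \<subseteq> I" "distinct (gs ! j)" if "j < ?N" for j
    using nth_mem[OF that] gs by (auto simp: distinct_concat_iff)
  have rv: "i \<in> I \<Longrightarrow> \<epsilon> i \<in> borel_measurable M" for i
    using ind by (auto simp: indep_vars_def)
  have bad: "bad p \<in> events \<and> prob (bad p) \<le> 2 * exp (- L)" if p: "p \<in> idx" for p
  proof -
    obtain j k where jk: "p = (j, k)" "j < ?N" "1 \<le> k" "k < length (gs ! j)"
      using p by (auto simp: idx_def)
    obtain c where c: "\<And>e. centred_partial_sum e (gs ! j) k = (\<Sum>v\<in>set (gs ! j). c v * e v)"
      "(\<Sum>v\<in>set (gs ! j). (c v)\<^sup>2) \<le> (bridge_sd (length (gs ! j)) k)\<^sup>2"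
      using centred_partial_sum_linear[OF block(3)[OF jk(2)] jk(4)] by blast
    have [measurable]: "i \<in> set (gs ! j) \<Longrightarrow> \<epsilon> i \<in> borel_measurable M" for i
      using rv block(2)[OF jk(2)] by auto
    have sd: "0 < bridge_sd (length (gs ! j)) k"
      using jk by (simp add: bridge_sd_def)
    have eq: "bad p = {\<omega> \<in> space M. \<sigma> * sqrt (2 * L) * sqrt ((bridge_sd (length (gs ! j)) k)\<^sup>2)
        < \<bar>\<Sum>v\<in>set (gs ! j). c v * \<epsilon> v \<omega>\<bar>}"
      using sd by (simp add: bad_def jk c)
    have "prob (bad p) \<le> 2 * exp (- L)"
      unfolding eq using block(2)[OF jk(2)] normal sd
      by (intro gaussian_linear_tail[OF \<sigma> _ indep_vars_subset[OF ind] _ c(2) _ L]) auto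
    moreover have "bad p \<in> events"
      unfolding eq by measurable
    ultimately show ?thesis by simp
  qed
  have large: "large \<in> events"
  proof -
    have [measurable]: "j < ?N \<Longrightarrow> i \<in> set (gs ! j) \<Longrightarrow> \<epsilon> i \<in> borel_measurable M" for i j
      using rv block(2) by auto
    have "(\<lambda>\<omega>. \<Sum>j<?N. (\<Sum>i\<in>set (gs ! j). \<epsilon> i \<omega>)\<^sup>2 / real (card (set (gs ! j)))) \<in> borel_measurable M"
      by (intro borel_measurable_sum borel_measurable_divide borel_measurable_power) auto
    then show ?thesis unfolding large_def by measurable
  qed
  have prob_large: "prob large \<le> exp (- t)"
    unfolding large_def using block normal
    by (intro gaussian_block_sums_tail[OF \<sigma> ind])
       (auto simp: disjoint_family_on_def distinct_concat_nth_disjoint[OF gs(1)])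
  have "finite idx" by (simp add: idx_def)
  have UN: "(\<Union>p\<in>idx. bad p) \<in> events"
    using bad \<open>finite idx\<close> by auto
  have "prob (\<Union>p\<in>idx. bad p) \<le> (\<Sum>p\<in>idx. prob (bad p))"
    using bad \<open>finite idx\<close> by (intro measure_UNION_le) auto
  also have "\<dots> \<le> (\<Sum>p\<in>idx. 2 * exp (- L))"
    using bad by (intro sum_mono) auto
  also have "\<dots> = real (card idx) * (2 * exp (- L))" by simp
  also have "real (card idx) = (\<Sum>j<?N. real (length (gs ! j)) - 1)"
  proof -
    have "card idx = (\<Sum>j<?N. length (gs ! j) - 1)"
      unfolding idx_def by (subst card_SigmaI) auto
    also have "real \<dots> = (\<Sum>j<?N. real (length (gs ! j)) - 1)"
      unfolding of_nat_sum using block(1)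
      by (intro sum.cong) (auto simp: of_nat_diff Suc_le_eq)
    finally show ?thesis .
  qed
  also have "\<dots> = real (length (concat gs)) - real ?N"
    by (simp add: sum_subtractf length_concat sum_list_sum_nth atLeast0LessThan)
  finally have "prob (large \<union> (\<Union>p\<in>idx. bad p))
      \<le> 2 * (real (length (concat gs)) - real ?N) * exp (- L) + exp (- t)"
    using measure_Un_le[OF large UN] prob_large by (simp add: algebra_simps)
  then have prob_G: "1 - (2 * (real (length (concat gs)) - real ?N) * exp (- L) + exp (- t)) \<le> prob G"
    unfolding G_def using large UN by (subst prob_compl) auto
  have "G \<in> events"
    unfolding G_def using large UN by auto
  moreover note prob_G
  moreover have "noise_small (\<sigma> * sqrt (2 * L)) (\<lambda>i. \<epsilon> i \<omega>) g" if \<omega>: "\<omega> \<in> G" and g: "g \<in> set gs" for \<omega> g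
  proof -
    obtain j where j: "j < ?N" "g = gs ! j"
      using g by (auto simp: in_set_conv_nth)
    have "\<omega> \<notin> bad (j, k)" if "1 \<le> k" "k < length g" for k
      using \<omega> j that by (auto simp: G_def idx_def)
    then show ?thesis
      using \<omega> j by (auto simp: noise_small_def bad_def G_def not_less)
  qed
  moreover have "(\<Sum>g\<leftarrow>gs. (\<Sum>v\<leftarrow>g. \<epsilon> v \<omega>)\<^sup>2 / real (length g))
      \<le> \<sigma>\<^sup>2 * (4 * t + 2 * ln 2 * real ?N)" if \<omega>: "\<omega> \<in> G" for \<omega>
  proof -
    have "(\<Sum>g\<leftarrow>gs. (\<Sum>v\<leftarrow>g. \<epsilon> v \<omega>)\<^sup>2 / real (length g))
        = (\<Sum>j<?N. (\<Sum>v\<leftarrow>gs ! j. \<epsilon> v \<omega>)\<^sup>2 / real (length (gs ! j)))"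
      by (simp add: sum_list_sum_nth[of "map _ gs"] atLeast0LessThan)
    also have "\<dots> = (\<Sum>j<?N. (\<Sum>i\<in>set (gs ! j). \<epsilon> i \<omega>)\<^sup>2 / real (card (set (gs ! j))))"
      using block(3) by (intro sum.cong) (auto simp: sum_list_distinct_conv_sum_set distinct_card)
    finally show ?thesis
      using \<omega> by (auto simp: G_def large_def)
  qed
  ultimately show ?thesis by (rule that)
qed


section \<open>Decompositions of the branched path\<close>

lemma parent_less:
  assumes "branched_path n1 n2 b" "i \<in> {2..n1 + n2}"
  shows "1 \<le> parent n1 b i" "parent n1 b i < i"
  using assms by (auto simp: parent_def branched_path_def)

lemma edge_diff_edge:
  assumes "branched_path n1 n2 b" "i \<in> {2..n1 + n2}"
  shows "edge_diff h (edge n1 b i) = \<bar>Dop n1 b h i\<bar>"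
  using parent_less[OF assms] by (simp add: edge_def edge_diff_pair Dop_def abs_minus_commute)

lemma inj_on_edge:
  assumes "branched_path n1 n2 b"
  shows "inj_on (edge n1 b) {2..n1 + n2}"
proof (rule inj_onI)
  fix i j assume "i \<in> {2..n1 + n2}" "j \<in> {2..n1 + n2}" and eq: "edge n1 b i = edge n1 b j"
  then have "parent n1 b i < i" "parent n1 b j < j"
    using parent_less[OF assms] by auto
  then have "Max (edge n1 b i) = i" "Max (edge n1 b j) = j"
    by (auto simp: edge_def max_def)
  with eq show "i = j" by metis
qed

lemma norm1_Dop_edges:
  assumes "branched_path n1 n2 b" "I \<subseteq> {2..n1 + n2}"
  shows "norm1 I (Dop n1 b h) = (\<Sum>E\<in>edge n1 b ` I. edge_diff h E)"
proof -
  have "(\<Sum>E\<in>edge n1 b ` I. edge_diff h E) = (\<Sum>i\<in>I. edge_diff h (edge n1 b i))"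
    by (rule sum.reindex_cong[OF inj_on_subset[OF inj_on_edge[OF assms(1)] assms(2)]]) auto
  also have "\<dots> = norm1 I (Dop n1 b h)"
    unfolding norm1_def using assms by (intro sum.cong) (auto simp: edge_diff_edge[OF assms(1)])
  finally show ?thesis by simp
qed

lemma sum_Un3_disjoint:
  assumes "finite A" "finite B" "finite C" "A \<inter> B = {}" "A \<inter> C = {}" "B \<inter> C = {}"
  shows "sum f (A \<union> B \<union> C) = sum f A + sum f B + sum f C"
proof -
  have "(A \<union> B) \<inter> C = {}" using assms by blast
  then have "sum f (A \<union> B \<union> C) = sum f (A \<union> B) + sum f C"
    using assms by (intro sum.union_disjoint) auto
  also have "sum f (A \<union> B) = sum f A + sum f B"
    using assms by (intro sum.union_disjoint) auto
  finally show ?thesis .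
qed

lemma list_first_middle_last:
  assumes "2 \<le> length d"
  obtains a ms z where "d = a # ms @ [z]"
proof -
  obtain a d' where d: "d = a # d'"
    using assms by (cases d) auto
  with assms have "d' \<noteq> []" by auto
  then have "d = a # butlast d' @ [last d']" by (simp add: d)
  then show ?thesis by (rule that)
qed

lemma tail_cost_snoc:
  "tail_cost (ms @ [z])
    = (\<Sum>k\<leftarrow>ms. 1 / real (k div 2) + 1 / real ((k + 1) div 2)) + 1 / real z"
proof (induction ms)
  case (Cons k ms)
  then show ?case by (cases ms) auto
qed simp

lemma tail_cost_Delta_part:
  assumes "2 \<le> length d"
  shows "1 / real (hd d) + tail_cost (tl d) = (\<Sum>x\<leftarrow>Delta_part d. 1 / real x)"
proof -
  obtain a ms z where d: "d = a # ms @ [z]"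
    using list_first_middle_last[OF assms] .
  have "(\<Sum>k\<leftarrow>ms. 1 / real (k div 2) + 1 / real ((k + 1) div 2))
      = (\<Sum>x\<leftarrow>concat (map (\<lambda>k. [k div 2, (k + 1) div 2]) ms). 1 / real x)"
    by (induction ms) auto
  then show ?thesis
    by (simp add: d tail_cost_snoc Delta_part_def)
qed

lemma length_Delta_part:
  assumes "2 \<le> length d"
  shows "length (Delta_part d) = 2 * (length d - 1)"
proof -
  obtain a ms z where d: "d = a # ms @ [z]"
    using list_first_middle_last[OF assms] .
  have "length (concat (map (\<lambda>k. [k div 2, (k + 1) div 2]) ms)) = 2 * length ms"
    by (induction ms) auto
  then show ?thesis
    by (simp add: d Delta_part_def)
qed

text \<open>
  The second claim gives the lower bound on \<open>n\<close> that makes the logarithm in the theorem at least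
  \<open>ln 2\<close>.
\<close>

lemma admissible_lengths_ge:
  assumes len: "2 \<le> length d" and adm: "admissible_lengths d"
  shows "\<And>x. x \<in> set d \<Longrightarrow> 2 \<le> x"
    and "hd d + last d + 4 * (length d - 2) \<le> sum_list d"
proof -
  obtain a ms z where d: "d = a # ms @ [z]"
    using list_first_middle_last[OF len] .
  have az: "2 \<le> a" "2 \<le> z"
    using adm by (auto simp: admissible_lengths_def d)
  have ms: "4 \<le> x" if x: "x \<in> set ms" for x
  proof -
    obtain j where "j < length ms" "ms ! j = x"
      using x by (auto simp: in_set_conv_nth)
    moreover have "\<forall>j. 1 \<le> j \<and> j < length d - 1 \<longrightarrow> d ! j \<ge> 4"
      using adm by (simp add: admissible_lengths_def)
    ultimately show ?thesis
      by (auto simp: d nth_append dest: spec[of _ "Suc j"])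
  qed
  show "2 \<le> x" if "x \<in> set d" for x
    using that az ms by (fastforce simp: d)
  have "4 * length ms \<le> sum_list ms"
    using sum_list_mono[of ms "\<lambda>_. 4" "\<lambda>x. x"] ms by (simp add: sum_list_triv mult.commute)
  then show "hd d + last d + 4 * (length d - 2) \<le> sum_list d"
    by (simp add: d)
qed

definition decomposition_segments ::
  "nat \<Rightarrow> nat \<Rightarrow> nat set \<Rightarrow> nat list \<Rightarrow> nat list \<Rightarrow> nat list \<Rightarrow> nat list list" where
  "decomposition_segments n1 b S p1 p2 p3 =
     concat (map (segments (edge n1 b ` S)) [p1, p2, p3])"

locale decomposed_branched_path =
  fixes n1 n2 b n :: nat and S :: "nat set" and p1 p2 p3 :: "nat list"
  assumes graph: "branched_path n1 n2 b" and n: "n = n1 + n2"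
    and S: "S \<subseteq> {2..n}"
    and parts: "S \<inter> {2..b} \<noteq> {}" "S \<inter> {b + 1..n1} \<noteq> {}" "S \<inter> {n1 + 1..n} \<noteq> {}"
    and dec: "admissible_decomposition n1 n2 b S p1 p2 p3"
begin

abbreviation "cuts \<equiv> edge n1 b ` S"
abbreviation "segs \<equiv> decomposition_segments n1 b S p1 p2 p3"
abbreviation "cost \<equiv> (\<Sum>x\<leftarrow>Delta n1 b S p1 p2 p3. 1 / real x)"

lemma finite_S: "finite S"
  using S finite_subset by blast

lemma distinct_paths:
  "distinct p1" "distinct p2" "distinct p3"
  "set p1 \<inter> set p2 = {}" "set p1 \<inter> set p3 = {}" "set p2 \<inter> set p3 = {}"
  using dec by (auto simp: admissible_decomposition_def)

lemma paths_nonempty: "p1 \<noteq> []" "p2 \<noteq> []" "p3 \<noteq> []"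
  using dec by (auto simp: admissible_decomposition_def)

lemma path_edges_disjoint:
  "path_edges p1 \<inter> path_edges p2 = {}" "path_edges p1 \<inter> path_edges p3 = {}"
  "path_edges p2 \<inter> path_edges p3 = {}"
  using path_edges_subset distinct_paths by blast+

lemma cuts_of_paths:
  "path_edges p1 \<inter> cuts = edge n1 b ` (S \<inter> {2..b})"
  "path_edges p2 \<inter> cuts = edge n1 b ` (S \<inter> {b + 1..n1})"
  "path_edges p3 \<inter> cuts = edge n1 b ` (S \<inter> {n1 + 1..n})"
  using dec n by (auto simp: admissible_decomposition_def)

lemma S_split: "S = (S \<inter> {2..b}) \<union> (S \<inter> {b + 1..n1}) \<union> (S \<inter> {n1 + 1..n})"
  using S by auto

lemma card_S: "card S = card (S \<inter> {2..b}) + card (S \<inter> {b + 1..n1}) + card (S \<inter> {n1 + 1..n})"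
proof -
  have "b < n1" using graph by (simp add: branched_path_def)
  then have "card ((S \<inter> {2..b}) \<union> (S \<inter> {b + 1..n1}) \<union> (S \<inter> {n1 + 1..n}))
      = card (S \<inter> {2..b}) + card (S \<inter> {b + 1..n1}) + card (S \<inter> {n1 + 1..n})"
    using finite_S unfolding card_eq_sum by (intro sum_Un3_disjoint) auto
  then show ?thesis unfolding S_split[symmetric] .
qed

lemma length_segments_paths:
  "length (segments cuts p1) = Suc (card (S \<inter> {2..b}))"
  "length (segments cuts p2) = Suc (card (S \<inter> {b + 1..n1}))"
  "length (segments cuts p3) = Suc (card (S \<inter> {n1 + 1..n}))"
proof -
  have inj: "card (edge n1 b ` (S \<inter> A)) = card (S \<inter> A)" for A
    by (rule card_image, rule inj_on_subset[OF inj_on_edge[OF graph]]) (use S n in auto)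
  show "length (segments cuts p1) = Suc (card (S \<inter> {2..b}))"
    using length_segments[OF distinct_paths(1) paths_nonempty(1), of cuts]
    by (simp only: cuts_of_paths inj)
  show "length (segments cuts p2) = Suc (card (S \<inter> {b + 1..n1}))"
    using length_segments[OF distinct_paths(2) paths_nonempty(2), of cuts]
    by (simp only: cuts_of_paths inj)
  show "length (segments cuts p3) = Suc (card (S \<inter> {n1 + 1..n}))"
    using length_segments[OF distinct_paths(3) paths_nonempty(3), of cuts]
    by (simp only: cuts_of_paths inj)
qed

lemma card_parts:
  "1 \<le> card (S \<inter> {2..b})" "1 \<le> card (S \<inter> {b + 1..n1})" "1 \<le> card (S \<inter> {n1 + 1..n})"
  using parts finite_S by (auto simp: Suc_le_eq card_gt_0_iff)

lemma card_S_ge: "3 \<le> card S"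
  using card_S card_parts by linarith

lemma seg_lengths_paths:
  "2 \<le> length (seg_lengths n1 b S p1)" "2 \<le> length (seg_lengths n1 b S p2)"
  "2 \<le> length (seg_lengths n1 b S p3)"
  using length_segments_paths card_parts by (simp_all add: seg_lengths_def)

lemma admissible_paths:
  "admissible_lengths (seg_lengths n1 b S p1)" "admissible_lengths (seg_lengths n1 b S p2)"
  "admissible_lengths (seg_lengths n1 b S p3)"
  using dec by (auto simp: admissible_decomposition_def)

lemma concat_segs: "concat segs = p1 @ p2 @ p3"
  by (simp add: decomposition_segments_def)

lemma distinct_concat_segs: "distinct (concat segs)"
  using dec unfolding concat_segs by (simp add: admissible_decomposition_def)

lemma set_concat_segs: "set (concat segs) = {1..n}"
  using dec n unfolding concat_segs by (simp add: admissible_decomposition_def)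

lemma length_concat_segs: "length (concat segs) = n"
  using distinct_card[OF distinct_concat_segs] unfolding set_concat_segs by simp

lemma length_segs: "length segs = card S + 3"
  using length_segments_paths card_S by (simp add: decomposition_segments_def)

lemma seg_length_ge: "g \<in> set segs \<Longrightarrow> 2 \<le> length g"
  using admissible_lengths_ge(1)[OF seg_lengths_paths(1) admissible_paths(1)]
    admissible_lengths_ge(1)[OF seg_lengths_paths(2) admissible_paths(2)]
    admissible_lengths_ge(1)[OF seg_lengths_paths(3) admissible_paths(3)]
  by (auto simp: decomposition_segments_def seg_lengths_def)

lemma sum_segs_vertices:
  fixes F :: "nat \<Rightarrow> real"
  shows "(\<Sum>g\<leftarrow>segs. \<Sum>v\<leftarrow>g. F v) = (\<Sum>i=1..n. F i)"
proof -
  have "(\<Sum>g\<leftarrow>gs. \<Sum>v\<leftarrow>g. F v) = (\<Sum>v\<leftarrow>concat gs. F v)" for gs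
    by (induction gs) auto
  then have "(\<Sum>g\<leftarrow>segs. \<Sum>v\<leftarrow>g. F v) = (\<Sum>v\<in>set (concat segs). F v)"
    unfolding sum_list_distinct_conv_sum_set[OF distinct_concat_segs, symmetric] .
  then show ?thesis unfolding set_concat_segs .
qed

lemma sum_seg_lengths: "(\<Sum>g\<leftarrow>segs. length g) = n"
  using length_concat_segs by (simp add: length_concat)

text \<open>Every edge of \<open>S\<close> is a cut of exactly one of the three paths.\<close>

lemma cut_variation_total:
  "cut_variation h (segments cuts p1) + cut_variation h (segments cuts p2)
     + cut_variation h (segments cuts p3) = norm1 S (Dop n1 b h)"
proof -
  have "cuts = edge n1 b ` ((S \<inter> {2..b}) \<union> (S \<inter> {b + 1..n1}) \<union> (S \<inter> {n1 + 1..n}))"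
    unfolding S_split[symmetric] ..
  then have "cuts = (path_edges p1 \<inter> cuts) \<union> (path_edges p2 \<inter> cuts) \<union> (path_edges p3 \<inter> cuts)"
    unfolding cuts_of_paths by (simp only: image_Un)
  moreover have "sum f ((path_edges p1 \<inter> cuts) \<union> (path_edges p2 \<inter> cuts) \<union> (path_edges p3 \<inter> cuts))
      = sum f (path_edges p1 \<inter> cuts) + sum f (path_edges p2 \<inter> cuts) + sum f (path_edges p3 \<inter> cuts)"
    for f :: "nat set \<Rightarrow> real"
    using path_edges_disjoint by (intro sum_Un3_disjoint) auto
  ultimately have "(\<Sum>E\<in>cuts. edge_diff h E) = (\<Sum>E\<in>path_edges p1 \<inter> cuts. edge_diff h E)
      + (\<Sum>E\<in>path_edges p2 \<inter> cuts. edge_diff h E) + (\<Sum>E\<in>path_edges p3 \<inter> cuts. edge_diff h E)"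
    by metis
  then show ?thesis
    using distinct_paths norm1_Dop_edges[OF graph, of S h] S n
    by (simp add: cut_variation_segments)
qed

text \<open>The two removed edges are missing on the left, whence only an inequality.\<close>

lemma inner_variation_total:
  "(\<Sum>g\<leftarrow>segs. inner_variation h g) \<le> norm1 ({2..n} - S) (Dop n1 b h)"
proof -
  have sub: "(path_edges p1 - cuts) \<union> (path_edges p2 - cuts) \<union> (path_edges p3 - cuts)
      \<subseteq> edge n1 b ` ({2..n} - S)"
  proof -
    obtain e e' where "path_edges p1 \<union> path_edges p2 \<union> path_edges p3
        = edge n1 b ` ({2..n1 + n2} - {e, e'})"
      using dec unfolding admissible_decomposition_def by (elim conjE exE)
    then have "path_edges p1 \<union> path_edges p2 \<union> path_edges p3 \<subseteq> edge n1 b ` {2..n}"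
      unfolding n by (simp add: image_mono)
    moreover have "edge n1 b ` {2..n} - cuts \<subseteq> edge n1 b ` ({2..n} - S)"
      by (rule image_diff_subset)
    ultimately show ?thesis
      by (auto simp only: Un_iff subset_iff Diff_iff)
  qed
  have "(\<Sum>g\<leftarrow>segs. inner_variation h g) = (\<Sum>E\<in>path_edges p1 - cuts. edge_diff h E)
      + (\<Sum>E\<in>path_edges p2 - cuts. edge_diff h E) + (\<Sum>E\<in>path_edges p3 - cuts. edge_diff h E)"
    using distinct_paths by (simp add: decomposition_segments_def inner_variation_segments)
  also have "\<dots> = (\<Sum>E\<in>(path_edges p1 - cuts) \<union> (path_edges p2 - cuts) \<union> (path_edges p3 - cuts).
      edge_diff h E)"
    using path_edges_disjoint by (intro sum_Un3_disjoint[symmetric]) auto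
  also have "\<dots> \<le> (\<Sum>E\<in>edge n1 b ` ({2..n} - S). edge_diff h E)"
    by (intro sum_mono2 sub) (auto simp: edge_diff_def)
  also have "\<dots> = norm1 ({2..n} - S) (Dop n1 b h)"
    unfolding n by (rule norm1_Dop_edges[OF graph, symmetric]) auto
  finally show ?thesis .
qed

lemma harmonic_mean_Delta:
  "2 * real (card S) / harmonic_mean (Delta n1 b S p1 p2 p3) = cost"
proof -
  have "length (Delta n1 b S p1 p2 p3) = 2 * card S"
    using length_Delta_part[OF seg_lengths_paths(1)] length_Delta_part[OF seg_lengths_paths(2)]
      length_Delta_part[OF seg_lengths_paths(3)] length_segments_paths card_S
    by (simp add: Delta_def seg_lengths_def)
  then show ?thesis
    using card_S_ge by (simp add: harmonic_mean_def)
qed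

lemma vertex_count:
  assumes "4 \<le> hd (seg_lengths n1 b S p1)" "4 \<le> last (seg_lengths n1 b S p2)"
    "4 \<le> last (seg_lengths n1 b S p3)"
  shows "4 * card S + 6 \<le> n"
proof -
  have ends: "2 \<le> last (seg_lengths n1 b S p1)" "2 \<le> hd (seg_lengths n1 b S p2)"
    "2 \<le> hd (seg_lengths n1 b S p3)"
    using admissible_paths by (auto simp: admissible_lengths_def)
  have "sum_list (seg_lengths n1 b S p1) + sum_list (seg_lengths n1 b S p2)
      + sum_list (seg_lengths n1 b S p3) = n"
    using sum_seg_lengths by (simp add: decomposition_segments_def seg_lengths_def)
  moreover have "length (seg_lengths n1 b S p1) + length (seg_lengths n1 b S p2)
      + length (seg_lengths n1 b S p3) = card S + 3"
    using length_segs by (simp add: decomposition_segments_def seg_lengths_def)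
  ultimately show ?thesis
    using admissible_lengths_ge(2)[OF seg_lengths_paths(1) admissible_paths(1)]
      admissible_lengths_ge(2)[OF seg_lengths_paths(2) admissible_paths(2)]
      admissible_lengths_ge(2)[OF seg_lengths_paths(3) admissible_paths(3)]
      assms ends seg_lengths_paths
    by linarith
qed

text \<open>
  The three paths together. The removed edges carry no flow and no noise, so the paths do not
  interact.
\<close>

lemma noise_excess_bound:
  assumes \<Lambda>: "0 \<le> \<Lambda>" and r: "0 \<le> r" "r * sqrt (real n) \<le> 1"
    and noise: "\<And>g. g \<in> set segs \<Longrightarrow> noise_small (\<Lambda> * r) e g"
  shows "(\<Sum>i=1..n. e i * h i) - \<Lambda> * norm1 ({2..n} - S) (Dop n1 b h) + \<Lambda> * norm1 S (Dop n1 b h)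
    \<le> (\<Sum>i=1..n. (h i)\<^sup>2) / 2 + (\<Sum>g\<leftarrow>segs. (\<Sum>v\<leftarrow>g. e v)\<^sup>2 / real (length g))
      + 2 * \<Lambda>\<^sup>2 * (cost + r\<^sup>2 * (\<Sum>g\<leftarrow>segs. bridge_roughness (length g)))"
proof -
  have sd: "r * bridge_sd (length g) k \<le> 1" if g: "g \<in> set segs" for g k
  proof -
    have "length g \<le> n"
      using member_le_sum_list[of "length g" "map length segs"] g sum_seg_lengths by auto
    then have "bridge_sd (length g) k \<le> sqrt (real n)"
      by (auto simp: bridge_sd_def)
    then show ?thesis
      using mult_left_mono[OF _ r(1)] r(2) by fastforce
  qed
  have path: "(\<Sum>g\<leftarrow>segments cuts p. chain_excess \<Lambda> e h g) + \<Lambda> * cut_variation h (segments cuts p)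
      \<le> 2 * \<Lambda>\<^sup>2 * ((\<Sum>x\<leftarrow>Delta_part (seg_lengths n1 b S p). 1 / real x)
          + r\<^sup>2 * (\<Sum>g\<leftarrow>segments cuts p. bridge_roughness (length g)))"
    if p: "p \<in> {p1, p2, p3}" for p
  proof -
    have sub: "set (segments cuts p) \<subseteq> set segs"
      using p by (auto simp: decomposition_segments_def)
    have len: "2 \<le> length (seg_lengths n1 b S p)"
      using p seg_lengths_paths by auto
    then have len': "2 \<le> length (segments cuts p)"
      by (simp add: seg_lengths_def)
    then obtain g gs where g: "segments cuts p = g # gs"
      by (cases "segments cuts p") auto
    with len' have "gs \<noteq> []" by auto
    note gs = g this
    have incl: "g' \<in> set segs" if "g' \<in> set (g # gs)" for g'
      using sub gs(1) that by auto
    have "(\<Sum>g\<leftarrow>g # gs. chain_excess \<Lambda> e h g) + \<Lambda> * cut_variation h (g # gs)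
        \<le> 2 * \<Lambda>\<^sup>2 * (1 / real (length g) + tail_cost (map length gs)
          + r\<^sup>2 * (\<Sum>g\<leftarrow>g # gs. bridge_roughness (length g)))"
      by (rule path_bound[OF \<Lambda> r(1) gs(2)]) (blast intro: incl noise sd seg_length_ge)+
    moreover have "1 / real (length g) + tail_cost (map length gs)
        = (\<Sum>x\<leftarrow>Delta_part (seg_lengths n1 b S p). 1 / real x)"
      using tail_cost_Delta_part[OF len] by (simp add: seg_lengths_def gs(1))
    ultimately show ?thesis
      unfolding gs(1) by simp
  qed
  have "(\<Sum>g\<leftarrow>segs. chain_excess \<Lambda> e h g) + \<Lambda> * norm1 S (Dop n1 b h)
      \<le> 2 * \<Lambda>\<^sup>2 * (cost + r\<^sup>2 * (\<Sum>g\<leftarrow>segs. bridge_roughness (length g)))"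
    using path[of p1] path[of p2] path[of p3] cut_variation_total[of h]
    by (simp add: decomposition_segments_def Delta_def algebra_simps flip: cut_variation_total)
  moreover have "(\<Sum>g\<leftarrow>segs. chain_excess \<Lambda> e h g) = (\<Sum>i=1..n. e i * h i)
      - \<Lambda> * (\<Sum>g\<leftarrow>segs. inner_variation h g) - (\<Sum>i=1..n. (h i)\<^sup>2) / 2
      - (\<Sum>g\<leftarrow>segs. (\<Sum>v\<leftarrow>g. e v)\<^sup>2 / real (length g))"
  proof -
    have "(\<Sum>g\<leftarrow>gs. chain_excess \<Lambda> e h g) = (\<Sum>g\<leftarrow>gs. \<Sum>v\<leftarrow>g. e v * h v)
        - \<Lambda> * (\<Sum>g\<leftarrow>gs. inner_variation h g) - (\<Sum>g\<leftarrow>gs. \<Sum>v\<leftarrow>g. (h v)\<^sup>2) / 2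
        - (\<Sum>g\<leftarrow>gs. (\<Sum>v\<leftarrow>g. e v)\<^sup>2 / real (length g))" for gs
      by (induction gs) (simp_all add: chain_excess_def algebra_simps add_divide_distrib)
    then show ?thesis by (simp only: sum_segs_vertices)
  qed
  moreover have "\<Lambda> * (\<Sum>g\<leftarrow>segs. inner_variation h g) \<le> \<Lambda> * norm1 ({2..n} - S) (Dop n1 b h)"
    by (intro mult_left_mono inner_variation_total \<Lambda>)
  ultimately show ?thesis by linarith
qed

text \<open>
  Jensen's inequality for the logarithm of the half lengths of the segments, in the form of the tangent
  bound \<open>ln x \<le> x / R - 1 + ln R\<close>. The half lengths add up to at most \<open>n / 2\<close>, and
  \<open>n / 2 / R < s + 3 / 2\<close>.
\<close>

lemma total_roughness_le:
  assumes R: "R = (real n + 1) / (2 * real (card S) + 3)"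
  shows "(\<Sum>g\<leftarrow>segs. bridge_roughness (length g)) \<le> (real (card S) + 3) * (2 + ln R / 2)"
proof -
  have R0: "0 < R" using R by simp
  have "(\<Sum>g\<leftarrow>segs. bridge_roughness (length g))
      \<le> (\<Sum>g\<leftarrow>segs. (3 + ln R) / 2 + 1 / (4 * R) * real (length g))"
  proof (rule sum_list_mono)
    fix g assume "g \<in> set segs"
    then have len: "2 \<le> length g" by (rule seg_length_ge)
    define m where "m = real (length g div 2)"
    have m: "0 < m" "m \<le> real (length g) / 2"
      using len by (auto simp: m_def)
    have "ln (m / R) \<le> m / R - 1"
      using m R0 by (intro ln_le_minus_one) auto
    then have "ln m \<le> m / R - 1 + ln R"
      using m R0 by (simp add: ln_div)
    moreover have "m / R \<le> real (length g) / 2 / R"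
      using m R0 by (intro divide_right_mono) auto
    ultimately have "ln m \<le> real (length g) / 2 / R - 1 + ln R"
      by linarith
    then have "ln m / 2 \<le> (ln R - 1) / 2 + real (length g) / (4 * R)"
      by (simp add: diff_divide_distrib add_divide_distrib)
    moreover have "bridge_roughness (length g) \<le> 2 + ln m / 2"
      using bridge_roughness_le[OF len] by (simp add: m_def)
    ultimately show "bridge_roughness (length g) \<le> (3 + ln R) / 2 + 1 / (4 * R) * real (length g)"
      by (simp add: field_simps)
  qed
  also have "\<dots> = real (length segs) * ((3 + ln R) / 2) + 1 / (4 * R) * real n"
  proof -
    have "(\<Sum>g\<leftarrow>gs. c + a * real (length g)) = real (length gs) * c + a * real (\<Sum>g\<leftarrow>gs. length g)"
      for gs :: "nat list list" and a c
      by (induction gs) (auto simp: algebra_simps)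
    then show ?thesis by (simp only: sum_seg_lengths)
  qed
  also have "1 / (4 * R) * real n \<le> (2 * real (card S) + 3) / 4"
  proof -
    have "real n \<le> (2 * real (card S) + 3) * R" by (simp add: R)
    then have "real n / R \<le> 2 * real (card S) + 3"
      using R0 by (simp add: divide_le_eq)
    then show ?thesis by simp
  qed
  finally show ?thesis
    by (simp add: length_segs field_simps)
qed

end


section \<open>The estimator\<close>

definition tv_penalty :: "nat \<Rightarrow> nat \<Rightarrow> nat \<Rightarrow> real \<Rightarrow> (nat \<Rightarrow> real) \<Rightarrow> real" where
  "tv_penalty n1 n2 b l f = 2 * l * norm1 {2..n1 + n2} (Dop n1 b f)"

lemma tv_estimator_eq:
  "tv_estimator n1 n2 b l Y = (SOME f. is_pls {1..n1 + n2} (1 / real (n1 + n2)) (tv_penalty n1 n2 b l) Y f)"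
proof -
  have "(\<lambda>f. emp_norm_sq (n1 + n2) (\<lambda>i. Y i - f i) + 2 * l * norm1 {2..n1 + n2} (Dop n1 b f))
      = pls_objective {1..n1 + n2} (1 / real (n1 + n2)) (tv_penalty n1 n2 b l) Y"
    by (simp add: fun_eq_iff pls_objective_def emp_norm_sq_def tv_penalty_def)
  then show ?thesis
    by (simp only: tv_estimator_def arg_min_def is_pls_def)
qed

lemma tv_penalty_convex:
  assumes graph: "branched_path n1 n2 b" and l: "0 \<le> l" and \<tau>: "0 \<le> \<tau>" "\<tau> \<le> 1"
  shows "tv_penalty n1 n2 b l (restrict (\<lambda>i. (1 - \<tau>) * f i + \<tau> * g i) {1..n1 + n2})
    \<le> (1 - \<tau>) * tv_penalty n1 n2 b l f + \<tau> * tv_penalty n1 n2 b l g"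
proof -
  have "norm1 {2..n1 + n2} (Dop n1 b (restrict (\<lambda>i. (1 - \<tau>) * f i + \<tau> * g i) {1..n1 + n2}))
      \<le> (\<Sum>i\<in>{2..n1 + n2}. (1 - \<tau>) * \<bar>Dop n1 b f i\<bar> + \<tau> * \<bar>Dop n1 b g i\<bar>)"
    unfolding norm1_def
  proof (rule sum_mono)
    fix i assume i: "i \<in> {2..n1 + n2}"
    then have "Dop n1 b (restrict (\<lambda>i. (1 - \<tau>) * f i + \<tau> * g i) {1..n1 + n2}) i
        = (1 - \<tau>) * Dop n1 b f i + \<tau> * Dop n1 b g i"
      using parent_less[OF graph i] by (simp add: Dop_def algebra_simps)
    then show "\<bar>Dop n1 b (restrict (\<lambda>i. (1 - \<tau>) * f i + \<tau> * g i) {1..n1 + n2}) i\<bar>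
        \<le> (1 - \<tau>) * \<bar>Dop n1 b f i\<bar> + \<tau> * \<bar>Dop n1 b g i\<bar>"
      using abs_triangle_ineq[of "(1 - \<tau>) * Dop n1 b f i" "\<tau> * Dop n1 b g i"] \<tau>
      by (simp add: abs_mult)
  qed
  also have "\<dots> = (1 - \<tau>) * norm1 {2..n1 + n2} (Dop n1 b f) + \<tau> * norm1 {2..n1 + n2} (Dop n1 b g)"
    by (simp add: norm1_def sum.distrib sum_distrib_left)
  finally have "2 * l * norm1 {2..n1 + n2} (Dop n1 b (restrict (\<lambda>i. (1 - \<tau>) * f i + \<tau> * g i) {1..n1 + n2}))
      \<le> 2 * l * ((1 - \<tau>) * norm1 {2..n1 + n2} (Dop n1 b f)
        + \<tau> * norm1 {2..n1 + n2} (Dop n1 b g))"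
    by (rule mult_left_mono) (use l in simp)
  then show ?thesis
    by (simp add: tv_penalty_def algebra_simps)
qed

lemma tv_estimator_is_pls:
  assumes "branched_path n1 n2 b" "0 \<le> l"
  shows "is_pls {1..n1 + n2} (1 / real (n1 + n2)) (tv_penalty n1 n2 b l) Y
    (tv_estimator n1 n2 b l Y)"
proof -
  have "continuous_on UNIV (\<lambda>f::nat \<Rightarrow> real. f i)" for i
    by (rule continuous_on_product_coordinates)
  then have "continuous_on UNIV (tv_penalty n1 n2 b l)"
    unfolding tv_penalty_def norm1_def Dop_def by (intro continuous_intros) auto
  moreover have "0 \<le> tv_penalty n1 n2 b l f" for f
    using assms(2) by (simp add: tv_penalty_def norm1_def sum_nonneg)
  moreover have "0 < 1 / real (n1 + n2)"
    using assms(1) by (simp add: branched_path_def)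
  ultimately obtain f where
    "is_pls {1..n1 + n2} (1 / real (n1 + n2)) (tv_penalty n1 n2 b l) Y f"
    using is_pls_exists[of "{1..n1 + n2}"] by blast
  then show ?thesis
    unfolding tv_estimator_eq
    by (rule someI[of "is_pls {1..n1 + n2} (1 / real (n1 + n2)) (tv_penalty n1 n2 b l) Y"])
qed

text \<open>
  The estimator reads its data only on the vertices, while the noise variables may be arbitrary
  functions at other indices.
\<close>

lemma tv_estimator_cong:
  assumes "\<And>i. i \<in> {1..n1 + n2} \<Longrightarrow> Y i = Y' i"
  shows "tv_estimator n1 n2 b l Y = tv_estimator n1 n2 b l Y'"
proof -
  have "emp_norm_sq (n1 + n2) (\<lambda>i. Y i - f i) = emp_norm_sq (n1 + n2) (\<lambda>i. Y' i - f i)" for f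
    unfolding emp_norm_sq_def using assms by (intro arg_cong2[of _ _ _ _ "(*)"] sum.cong) auto
  then show ?thesis by (simp add: tv_estimator_def)
qed

lemma tv_risk_measurable:
  assumes graph: "branched_path n1 n2 b" and l: "0 \<le> l"
    and eps: "\<And>i. i \<in> {1..n1 + n2} \<Longrightarrow> eps i \<in> borel_measurable M"
  shows "(\<lambda>\<omega>. emp_norm_sq (n1 + n2) (\<lambda>i. tv_estimator n1 n2 b l (\<lambda>i. f0 i + eps i \<omega>) i - f0 i))
    \<in> borel_measurable M"
proof -
  define Y where "Y \<omega> i = (if i \<in> {1..n1 + n2} then f0 i + eps i \<omega> else 0)" for \<omega> i
  have Y: "Y \<in> borel_measurable M"
  proof (rule measurable_coordinatewise_then_product)
    fix i
    show "(\<lambda>\<omega>. Y \<omega> i) \<in> borel_measurable M"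
      using eps[of i] by (cases "i \<in> {1..n1 + n2}") (auto simp: Y_def)
  qed
  have "(\<lambda>\<omega>. tv_estimator n1 n2 b l (\<lambda>i. f0 i + eps i \<omega>) i) \<in> borel_measurable M"
    if i: "i \<in> {1..n1 + n2}" for i
  proof -
    have "0 < 1 / real (n1 + n2)"
      using graph by (simp add: branched_path_def)
    then have "continuous_on UNIV (\<lambda>Y. tv_estimator n1 n2 b l Y i)"
      by (rule is_pls_continuous[OF _ _ tv_estimator_is_pls[OF graph l] tv_penalty_convex[OF graph l] i])
        auto
    then have "(\<lambda>Y. tv_estimator n1 n2 b l Y i) \<in> borel_measurable borel"
      by (rule borel_measurable_continuous_onI)
    from measurable_compose[OF Y this]
    have "(\<lambda>\<omega>. tv_estimator n1 n2 b l (Y \<omega>) i) \<in> borel_measurable M" .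
    moreover have "tv_estimator n1 n2 b l (Y \<omega>) = tv_estimator n1 n2 b l (\<lambda>i. f0 i + eps i \<omega>)" for \<omega>
      by (rule tv_estimator_cong) (simp add: Y_def)
    ultimately show ?thesis by simp
  qed
  then show ?thesis
    unfolding emp_norm_sq_def by measurable
qed

text \<open>
  The growth inequality at \<open>f\<close>, expanded around \<open>f0\<close>. By the triangle inequality the penalty difference
  is at most the variation of \<open>h\<close> on \<open>S\<close> minus that off \<open>S\<close>, up to twice the variation of \<open>f\<close> off
  \<open>S\<close>.
\<close>

lemma tv_basic_inequality:
  fixes f f0 e :: "nat \<Rightarrow> real"
  assumes graph: "branched_path n1 n2 b" and n: "n = n1 + n2" and l: "0 \<le> l"
    and S: "S \<subseteq> {2..n}" and f: "f \<in> extensional {1..n}"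
  defines "fhat \<equiv> tv_estimator n1 n2 b l (\<lambda>i. f0 i + e i)"
  defines "h \<equiv> \<lambda>i. fhat i - f i"
  shows "emp_norm_sq n (\<lambda>i. fhat i - f0 i)
    \<le> emp_norm_sq n (\<lambda>i. f i - f0 i) + 4 * l * norm1 ({2..n} - S) (Dop n1 b f)
      + 2 / real n * ((\<Sum>i=1..n. e i * h i) - l * real n * norm1 ({2..n} - S) (Dop n1 b h)
          + l * real n * norm1 S (Dop n1 b h) - (\<Sum>i=1..n. (h i)\<^sup>2) / 2)"
proof -
  let ?Y = "\<lambda>i. f0 i + e i"
  have n0: "0 < real n"
    using graph n by (simp add: branched_path_def)
  have "pls_objective {1..n} (1 / real n) (tv_penalty n1 n2 b l) ?Y fhat
      + 1 / real n * (\<Sum>i=1..n. (f i - fhat i)\<^sup>2)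
    \<le> pls_objective {1..n} (1 / real n) (tv_penalty n1 n2 b l) ?Y f"
    unfolding fhat_def n using n0 f n
    by (intro is_pls_growth tv_estimator_is_pls[OF graph l] tv_penalty_convex[OF graph l]) auto
  then have opt: "1 / real n * (\<Sum>i=1..n. (?Y i - fhat i)\<^sup>2) - 1 / real n * (\<Sum>i=1..n. (?Y i - f i)\<^sup>2)
      + 1 / real n * (\<Sum>i=1..n. (h i)\<^sup>2)
    \<le> 2 * l * (norm1 {2..n} (Dop n1 b f) - norm1 {2..n} (Dop n1 b fhat))"
    by (simp add: pls_objective_def tv_penalty_def n h_def power2_commute algebra_simps)
  have "(\<Sum>i=1..n. (?Y i - fhat i)\<^sup>2) - (\<Sum>i=1..n. (?Y i - f i)\<^sup>2)
      = (\<Sum>i=1..n. (fhat i - f0 i)\<^sup>2 - (f i - f0 i)\<^sup>2 - 2 * (e i * h i))"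
    unfolding sum_subtractf[symmetric]
    by (intro sum.cong) (auto simp: h_def power2_eq_square algebra_simps)
  also have "\<dots> = (\<Sum>i=1..n. (fhat i - f0 i)\<^sup>2) - (\<Sum>i=1..n. (f i - f0 i)\<^sup>2) - 2 * (\<Sum>i=1..n. e i * h i)"
    by (simp add: sum_subtractf sum_distrib_left)
  finally have sq: "(\<Sum>i=1..n. (?Y i - fhat i)\<^sup>2) - (\<Sum>i=1..n. (?Y i - f i)\<^sup>2)
      = (\<Sum>i=1..n. (fhat i - f0 i)\<^sup>2) - (\<Sum>i=1..n. (f i - f0 i)\<^sup>2) - 2 * (\<Sum>i=1..n. e i * h i)" .
  have expand: "1 / real n * (\<Sum>i=1..n. (?Y i - fhat i)\<^sup>2)
        - 1 / real n * (\<Sum>i=1..n. (?Y i - f i)\<^sup>2)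
      = emp_norm_sq n (\<lambda>i. fhat i - f0 i) - emp_norm_sq n (\<lambda>i. f i - f0 i)
        - 2 / real n * (\<Sum>i=1..n. e i * h i)"
    unfolding right_diff_distrib[symmetric] sq by (simp add: emp_norm_sq_def right_diff_distrib)
  have split: "norm1 {2..n} v = norm1 S v + norm1 ({2..n} - S) v" for v
    unfolding norm1_def using sum.subset_diff[OF S, of "\<lambda>i. \<bar>v i\<bar>"] by simp
  have "norm1 S (Dop n1 b f) - norm1 S (Dop n1 b fhat) \<le> norm1 S (Dop n1 b h)"
    unfolding norm1_def sum_subtractf[symmetric] by (intro sum_mono) (simp add: Dop_def h_def)
  moreover have "norm1 ({2..n} - S) (Dop n1 b f) - norm1 ({2..n} - S) (Dop n1 b fhat)
      \<le> (\<Sum>i\<in>{2..n} - S. 2 * \<bar>Dop n1 b f i\<bar> - \<bar>Dop n1 b h i\<bar>)"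
    unfolding norm1_def sum_subtractf[symmetric] by (intro sum_mono) (simp add: Dop_def h_def)
  ultimately have "norm1 {2..n} (Dop n1 b f) - norm1 {2..n} (Dop n1 b fhat)
      \<le> norm1 S (Dop n1 b h) + 2 * norm1 ({2..n} - S) (Dop n1 b f) - norm1 ({2..n} - S) (Dop n1 b h)"
    unfolding split by (simp add: sum_subtractf sum_distrib_left norm1_def)
  then have pen: "2 * l * (norm1 {2..n} (Dop n1 b f) - norm1 {2..n} (Dop n1 b fhat))
      \<le> 2 * l * (norm1 S (Dop n1 b h) + 2 * norm1 ({2..n} - S) (Dop n1 b f)
        - norm1 ({2..n} - S) (Dop n1 b h))"
    using l by (intro mult_left_mono) auto
  have "2 / real n * ((\<Sum>i=1..n. e i * h i) - l * real n * norm1 ({2..n} - S) (Dop n1 b h)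
          + l * real n * norm1 S (Dop n1 b h) - (\<Sum>i=1..n. (h i)\<^sup>2) / 2)
      = 2 / real n * (\<Sum>i=1..n. e i * h i) - 2 * l * norm1 ({2..n} - S) (Dop n1 b h)
        + 2 * l * norm1 S (Dop n1 b h) - 1 / real n * (\<Sum>i=1..n. (h i)\<^sup>2)"
    using n0 by (simp add: field_simps)
  then show ?thesis
    using opt pen unfolding expand by (simp add: algebra_simps)
qed


section \<open>The oracle inequality\<close>

text \<open>
  The first term on the left comes from the projection of the noise onto \<open>s + 3\<close> dimensions, the second
  from the roughness of the weights. The logarithm on the right, whose argument is at least \<open>2\<close>,
  dominates the roughness and absorbs the two dimensions in excess of \<open>s + 1\<close>.
\<close>

lemma remainder_le:
  fixes s n L :: real
  assumes s: "3 \<le> s" and n: "4 * s + 6 \<le> n" and L: "1 \<le> L"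
  defines "R \<equiv> (n + 1) / (2 * s + 3)"
  shows "4 * ln 2 * (s + 3) + 8 * L * ((s + 3) * (2 + ln R / 2))
    \<le> 4 * (s + 1) + 8 * L * (5 * (2 * s + 3) / 2 * ln R)"
proof -
  have "2 \<le> R"
    using s n by (simp add: R_def le_divide_eq)
  then have lnR: "2 / 3 \<le> ln R"
    using ln2_ge_two_thirds ln_mono[of 2 R] by linarith
  have "(9 / 2 * s + 6) * (2 / 3) \<le> (9 / 2 * s + 6) * ln R"
    using s lnR by (intro mult_left_mono) auto
  then have "3 * s + 4 \<le> (9 / 2 * s + 6) * ln R"
    by simp
  moreover have "5 * (2 * s + 3) / 2 * ln R - (s + 3) * (2 + ln R / 2)
      = (9 / 2 * s + 6) * ln R - 2 * s - 6"
    by (simp add: field_simps)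
  ultimately have "1 \<le> 5 * (2 * s + 3) / 2 * ln R - (s + 3) * (2 + ln R / 2)"
    using s by linarith
  then have "L * 1 \<le> L * (5 * (2 * s + 3) / 2 * ln R - (s + 3) * (2 + ln R / 2))"
    using L by (intro mult_left_mono) auto
  then have "L \<le> L * (5 * (2 * s + 3) / 2 * ln R) - L * ((s + 3) * (2 + ln R / 2))"
    by (simp only: right_diff_distrib mult_1_right)
  moreover have "ln 2 \<le> (1::real)"
    using ln_le_minus_one[of "2::real"] by simp
  then have "ln 2 * (4 * (s + 3)) \<le> 1 * (4 * (s + 3))"
    using s by (intro mult_right_mono) auto
  then have "4 * ln 2 * (s + 3) \<le> 4 * (s + 1) + 8"
    by (simp add: algebra_simps)
  ultimately show ?thesis
    using L unfolding mult.assoc[of 8 L] by linarith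
qed

context decomposed_branched_path
begin

abbreviation "H \<equiv> harmonic_mean (Delta n1 b S p1 p2 p3)"

text \<open>
  \<open>\<Lambda> * r = \<sigma> * sqrt (2 * L)\<close> identifies the noise level of the event with the fraction \<open>r\<close> of the penalty;
  the factor \<open>\<gamma>\<close> in \<open>l\<close> is what makes \<open>r * sqrt n = 1 / \<gamma>\<close> smaller than \<open>1\<close>. With
  \<open>l\<^sup>2 * n = 2 * \<gamma>\<^sup>2 * \<sigma>\<^sup>2 * L\<close> the tents then give the harmonic mean term and the bridge weights the
  logarithmic term.
\<close>

lemma tv_oracle_inequality:
  fixes \<sigma> \<gamma> \<delta> :: real and f f0 e :: "nat \<Rightarrow> real"
  assumes par: "\<sigma> > 0" "\<gamma> > 1" "0 < \<delta>" "\<delta> < 1"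
    and size: "4 * card S + 6 \<le> n"
  defines "L \<equiv> ln (4 * (real n - real (card S) - 1) / \<delta>)"
    and "l \<equiv> tuning n (card S) \<sigma> \<gamma> \<delta>"
  defines "fhat \<equiv> tv_estimator n1 n2 b l (\<lambda>i. f0 i + e i)"
  assumes noise: "\<And>g. g \<in> set segs \<Longrightarrow> noise_small (\<sigma> * sqrt (2 * L)) e g"
    and means: "(\<Sum>g\<leftarrow>segs. (\<Sum>v\<leftarrow>g. e v)\<^sup>2 / real (length g))
      \<le> \<sigma>\<^sup>2 * (4 * ln (2 / \<delta>) + 2 * ln 2 * real (length segs))"
    and f: "f \<in> extensional {1..n}"
  shows "emp_norm_sq n (\<lambda>i. fhat i - f0 i)
    \<le> emp_norm_sq n (\<lambda>i. f i - f0 i) + 4 * l * norm1 ({2..n} - S) (Dop n1 b f)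
      + (8 * ln (2 / \<delta>) * \<sigma>\<^sup>2 / real n + 4 * \<sigma>\<^sup>2 * ((real (card S) + 1) / real n)
      + 8 * \<sigma>\<^sup>2 * L * (2 * \<gamma>\<^sup>2 * real (card S) / H
          + 5 * (2 * real (card S) + 3) / (2 * real n)
            * ln ((real n + 1) / (2 * real (card S) + 3))))"
proof -
  define s where "s = real (card S)"
  define R where "R = (real n + 1) / (2 * s + 3)"
  define \<Lambda> where "\<Lambda> = l * real n"
  define r where "r = 1 / (\<gamma> * sqrt (real n))"
  define B where "B = (\<Sum>g\<leftarrow>segs. bridge_roughness (length g))"
  define X where "X = (\<Sum>g\<leftarrow>segs. (\<Sum>v\<leftarrow>g. e v)\<^sup>2 / real (length g))"
  define h where "h i = fhat i - f i" for i
  have s: "3 \<le> s" "4 * s + 6 \<le> real n"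
    using card_S_ge size by (auto simp: s_def)
  then have n0: "0 < real n" by simp
  have L: "1 \<le> L"
  proof -
    have "4 * \<delta> \<le> 4 * (real n - s - 1)"
      using s par by simp
    then have "4 \<le> 4 * (real n - s - 1) / \<delta>"
      using par by (simp add: le_divide_eq)
    then have "exp 1 \<le> 4 * (real n - s - 1) / \<delta>"
      using exp_le by linarith
    moreover from this have "0 < 4 * (real n - s - 1) / \<delta>"
      using exp_gt_zero[of "1::real"] by linarith
    ultimately show ?thesis
      by (simp add: L_def s_def ln_ge_iff)
  qed
  have l_eq: "l = \<gamma> * \<sigma> * sqrt (2 * L / real n)"
    by (simp add: l_def tuning_def L_def)
  have l0: "0 \<le> l" using par L by (simp add: l_eq)
  have l2: "l\<^sup>2 * real n = \<gamma>\<^sup>2 * \<sigma>\<^sup>2 * (2 * L)"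
    using L n0 by (simp add: l_eq power_mult_distrib)
  have "\<Lambda> * r = \<sigma> * (sqrt (2 * L) / sqrt (real n) * (real n / sqrt (real n)))"
    using par by (simp add: \<Lambda>_def r_def l_eq real_sqrt_divide)
  also have "\<dots> = \<sigma> * sqrt (2 * L)"
    using n0 by (simp add: real_div_sqrt)
  finally have \<Lambda>r: "\<Lambda> * r = \<sigma> * sqrt (2 * L)" .
  have "(\<Sum>i=1..n. e i * h i) - \<Lambda> * norm1 ({2..n} - S) (Dop n1 b h) + \<Lambda> * norm1 S (Dop n1 b h)
      \<le> (\<Sum>i=1..n. (h i)\<^sup>2) / 2 + X + 2 * \<Lambda>\<^sup>2 * (cost + r\<^sup>2 * B)"
    unfolding X_def B_def
  proof (rule noise_excess_bound)
    show "0 \<le> \<Lambda>" using l0 by (simp add: \<Lambda>_def)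
    show "0 \<le> r" using par by (simp add: r_def)
    show "r * sqrt (real n) \<le> 1"
      using par n0 by (simp add: r_def)
    show "noise_small (\<Lambda> * r) e g" if "g \<in> set segs" for g
      unfolding \<Lambda>r by (rule noise[OF that])
  qed
  then have "2 / real n * ((\<Sum>i=1..n. e i * h i) - \<Lambda> * norm1 ({2..n} - S) (Dop n1 b h)
        + \<Lambda> * norm1 S (Dop n1 b h) - (\<Sum>i=1..n. (h i)\<^sup>2) / 2)
      \<le> 2 / real n * (X + 2 * \<Lambda>\<^sup>2 * (cost + r\<^sup>2 * B))"
    by (intro mult_left_mono) auto
  also have "\<dots> = (2 * X + 8 * \<sigma>\<^sup>2 * L * B) / real n + 8 * \<sigma>\<^sup>2 * L * \<gamma>\<^sup>2 * cost"
  proof -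
    have "2 / real n * (2 * \<Lambda>\<^sup>2 * cost) = 4 * (l\<^sup>2 * real n) * cost"
      using n0 by (simp add: \<Lambda>_def power2_eq_square)
    moreover have "r\<^sup>2 = 1 / (\<gamma>\<^sup>2 * real n)"
      by (simp add: r_def power_mult_distrib power_divide)
    then have "2 / real n * (2 * \<Lambda>\<^sup>2 * (r\<^sup>2 * B)) = 4 * (l\<^sup>2 * real n) * B / (\<gamma>\<^sup>2 * real n)"
      using n0 by (simp add: \<Lambda>_def power2_eq_square)
    ultimately show ?thesis
      using par unfolding l2 by (simp add: algebra_simps add_divide_distrib)
  qed
  also have "8 * \<sigma>\<^sup>2 * L * \<gamma>\<^sup>2 * cost = 8 * \<sigma>\<^sup>2 * L * (2 * \<gamma>\<^sup>2 * s / H)"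
    using harmonic_mean_Delta by (simp add: s_def flip: harmonic_mean_Delta)
  also have "(2 * X + 8 * \<sigma>\<^sup>2 * L * B) / real n
      \<le> (8 * ln (2 / \<delta>) * \<sigma>\<^sup>2 + \<sigma>\<^sup>2 * (4 * (s + 1) + 8 * L * (5 * (2 * s + 3) / 2 * ln R))) / real n"
  proof (rule divide_right_mono)
    have "2 * X \<le> 8 * ln (2 / \<delta>) * \<sigma>\<^sup>2 + \<sigma>\<^sup>2 * (4 * ln 2 * (s + 3))"
      using means by (simp add: X_def length_segs s_def algebra_simps)
    moreover have "\<sigma>\<^sup>2 * (8 * L * B) \<le> \<sigma>\<^sup>2 * (8 * L * ((s + 3) * (2 + ln R / 2)))"
      using total_roughness_le[of R] L by (intro mult_left_mono) (auto simp: R_def B_def s_def)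
    moreover have "\<sigma>\<^sup>2 * (4 * ln 2 * (s + 3) + 8 * L * ((s + 3) * (2 + ln R / 2)))
        \<le> \<sigma>\<^sup>2 * (4 * (s + 1) + 8 * L * (5 * (2 * s + 3) / 2 * ln R))"
      unfolding R_def by (intro mult_left_mono remainder_le s L) auto
    ultimately show "2 * X + 8 * \<sigma>\<^sup>2 * L * B
        \<le> 8 * ln (2 / \<delta>) * \<sigma>\<^sup>2 + \<sigma>\<^sup>2 * (4 * (s + 1) + 8 * L * (5 * (2 * s + 3) / 2 * ln R))"
      by (simp add: algebra_simps)
  qed simp
  finally have main: "2 / real n * ((\<Sum>i=1..n. e i * h i) - \<Lambda> * norm1 ({2..n} - S) (Dop n1 b h)
        + \<Lambda> * norm1 S (Dop n1 b h) - (\<Sum>i=1..n. (h i)\<^sup>2) / 2)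
      \<le> (8 * ln (2 / \<delta>) * \<sigma>\<^sup>2 + \<sigma>\<^sup>2 * (4 * (s + 1) + 8 * L * (5 * (2 * s + 3) / 2 * ln R))) / real n
        + 8 * \<sigma>\<^sup>2 * L * (2 * \<gamma>\<^sup>2 * s / H)"
    by simp
  have "emp_norm_sq n (\<lambda>i. fhat i - f0 i)
    \<le> emp_norm_sq n (\<lambda>i. f i - f0 i) + 4 * l * norm1 ({2..n} - S) (Dop n1 b f)
      + 2 / real n * ((\<Sum>i=1..n. e i * h i) - \<Lambda> * norm1 ({2..n} - S) (Dop n1 b h)
          + \<Lambda> * norm1 S (Dop n1 b h) - (\<Sum>i=1..n. (h i)\<^sup>2) / 2)"
    unfolding \<Lambda>_def h_def fhat_def by (rule tv_basic_inequality[OF graph n l0 S f])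
  also have "\<dots> \<le> emp_norm_sq n (\<lambda>i. f i - f0 i) + 4 * l * norm1 ({2..n} - S) (Dop n1 b f)
      + ((8 * ln (2 / \<delta>) * \<sigma>\<^sup>2 + \<sigma>\<^sup>2 * (4 * (s + 1) + 8 * L * (5 * (2 * s + 3) / 2 * ln R))) / real n
        + 8 * \<sigma>\<^sup>2 * L * (2 * \<gamma>\<^sup>2 * s / H))"
    by (intro add_left_mono main)
  also have "(8 * ln (2 / \<delta>) * \<sigma>\<^sup>2 + \<sigma>\<^sup>2 * (4 * (s + 1) + 8 * L * (5 * (2 * s + 3) / 2 * ln R))) / real n
        + 8 * \<sigma>\<^sup>2 * L * (2 * \<gamma>\<^sup>2 * s / H)
      = 8 * ln (2 / \<delta>) * \<sigma>\<^sup>2 / real n + 4 * \<sigma>\<^sup>2 * ((s + 1) / real n)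
      + 8 * \<sigma>\<^sup>2 * L * (2 * \<gamma>\<^sup>2 * s / H + 5 * (2 * s + 3) / (2 * real n) * ln R)"
    by (simp add: add_divide_distrib algebra_simps)
  finally show ?thesis
    by (simp only: s_def R_def)
qed

end

text \<open>
  As \<open>n \<ge> 4 * s + 6\<close>, both \<open>ln n\<close> and \<open>ln (n / s)\<close> are at least \<open>1\<close>, so the terms of order \<open>1 / n\<close>
  and \<open>s / n\<close> are dominated by the second rate; \<open>K * ln n\<close> bounds the logarithm from the tuning
  parameter.
\<close>

lemma rate_le:
  fixes s n a z \<sigma> \<gamma> \<delta> :: real
  assumes par: "0 < \<delta>" "\<delta> < 1" and s: "3 \<le> s" and n: "4 * s + 6 \<le> n"
    and a: "0 \<le> a" and z: "0 \<le> z"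
  defines "K \<equiv> ln (4 / \<delta>) + 1"
  shows "8 * ln (2 / \<delta>) * \<sigma>\<^sup>2 / n + 4 * \<sigma>\<^sup>2 * ((s + 1) / n)
      + 8 * \<sigma>\<^sup>2 * ln (4 * (n - s - 1) / \<delta>)
        * (2 * \<gamma>\<^sup>2 * a + 5 * (2 * s + 3) / (2 * n) * ln ((n + 1) / (2 * s + 3)) + z / n)
    \<le> 16 * \<sigma>\<^sup>2 * \<gamma>\<^sup>2 * K * (ln n * a)
      + (8 * ln (2 / \<delta>) * \<sigma>\<^sup>2 + 8 * \<sigma>\<^sup>2 + 60 * \<sigma>\<^sup>2 * K) * (ln n * ln (n / s) * s / n)
      + 8 * \<sigma>\<^sup>2 * K * (ln n * z / n)"
proof -
  define X where "X = ln n * ln (n / s) * s / n"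
  define L where "L = ln (4 * (n - s - 1) / \<delta>)"
  have n0: "0 < n" "0 < s" using s n by auto
  have ln_ge_1: "1 \<le> ln x" if "3 \<le> x" for x :: real
    using that exp_le by (subst ln_ge_iff) auto
  have lnn: "1 \<le> ln n" using s n by (intro ln_ge_1) auto
  have lns: "1 \<le> ln (n / s)" using s n by (intro ln_ge_1) (simp add: le_divide_eq)
  have prod: "1 \<le> ln n * ln (n / s)"
    using mult_mono[OF lnn lns] lnn by simp
  then have sX: "s / n \<le> X"
    using n0 mult_right_mono[OF prod, of "s / n"] by (simp add: X_def)
  then have X: "0 \<le> X" "1 / n \<le> X" "(s + 1) / n \<le> 2 * X"
    using s n0 divide_right_mono[of 1 s n] by (auto simp: add_divide_distrib intro: order_trans[OF _ sX])
  have ln4: "0 \<le> ln (4 / \<delta>)" using par by simp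
  have "L = ln (4 / \<delta>) + ln (n - s - 1)"
    using par s n ln_mult[of "4 / \<delta>" "n - s - 1"] by (simp add: L_def)
  also have "\<dots> \<le> ln (4 / \<delta>) * ln n + ln n"
    using s n ln4 lnn mult_left_mono[OF lnn ln4] by (intro add_mono) auto
  finally have LK: "L \<le> K * ln n"
    by (simp add: K_def algebra_simps)
  have lnR: "0 \<le> ln ((n + 1) / (2 * s + 3))" "ln ((n + 1) / (2 * s + 3)) \<le> ln (n / s)"
  proof -
    show "0 \<le> ln ((n + 1) / (2 * s + 3))"
      using s n by (intro ln_ge_zero) (simp add: le_divide_eq)
    have "s \<le> n * 3 + n * s"
      using s n by (simp add: add_increasing2)
    then have "(n + 1) / (2 * s + 3) \<le> n / s"
      using s n0 by (simp add: field_simps)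
    then show "ln ((n + 1) / (2 * s + 3)) \<le> ln (n / s)"
      using s n0 by (intro ln_mono) auto
  qed
  have coef: "5 * (2 * s + 3) / (2 * n) \<le> 15 * s / (2 * n)"
    using s n0 by (intro divide_right_mono) auto
  have Q: "2 * \<gamma>\<^sup>2 * a + 5 * (2 * s + 3) / (2 * n) * ln ((n + 1) / (2 * s + 3)) + z / n
      \<le> 2 * \<gamma>\<^sup>2 * a + 15 * s / (2 * n) * ln (n / s) + z / n" (is "?Q \<le> ?Q'")
    using lnR coef s n0 a z by (intro add_mono mult_mono) auto
  have Q0: "0 \<le> ?Q"
    using a z s n0 lnR by (intro add_nonneg_nonneg mult_nonneg_nonneg divide_nonneg_nonneg) auto
  have K0: "0 \<le> K * ln n" using ln4 lnn by (simp add: K_def)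
  have "L * ?Q \<le> K * ln n * ?Q'"
    using LK Q Q0 K0 by (intro mult_mono) auto
  then have "8 * \<sigma>\<^sup>2 * (L * ?Q) \<le> 8 * \<sigma>\<^sup>2 * (K * ln n * ?Q')"
    by (intro mult_left_mono) auto
  also have "\<dots> = 16 * \<sigma>\<^sup>2 * \<gamma>\<^sup>2 * K * (ln n * a) + 60 * \<sigma>\<^sup>2 * K * X + 8 * \<sigma>\<^sup>2 * K * (ln n * z / n)"
    using n0 by (simp add: X_def field_simps)
  finally have 1: "8 * \<sigma>\<^sup>2 * L * ?Q
      \<le> 16 * \<sigma>\<^sup>2 * \<gamma>\<^sup>2 * K * (ln n * a) + 60 * \<sigma>\<^sup>2 * K * X + 8 * \<sigma>\<^sup>2 * K * (ln n * z / n)"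
    by (simp add: mult.assoc)
  have "8 * ln (2 / \<delta>) * \<sigma>\<^sup>2 * (1 / n) \<le> 8 * ln (2 / \<delta>) * \<sigma>\<^sup>2 * X"
    using X par by (intro mult_left_mono) auto
  moreover have "4 * \<sigma>\<^sup>2 * ((s + 1) / n) \<le> 4 * \<sigma>\<^sup>2 * (2 * X)"
    using X by (intro mult_left_mono) auto
  ultimately show ?thesis
    using 1 unfolding X_def[symmetric] L_def[symmetric] by (simp add: algebra_simps)
qed

lemma zeta_nonneg: "0 \<le> zeta n1 n2 b S"
  by (simp add: zeta_def zeta_fun_def Let_def)


section \<open>Probability bound and rate\<close>

theorem corollary5p4:
  fixes \<sigma> \<gamma> \<delta> :: real
  assumes "\<sigma> > 0" and "\<gamma> > 1" and "0 < \<delta>" and "\<delta> < 1"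
  shows "\<exists>(C1::real) (C2::real) (C3::real) (N::nat).
    \<forall>(M :: 'a measure) (eps :: nat \<Rightarrow> 'a \<Rightarrow> real) (f0 :: nat \<Rightarrow> real)
      (n1::nat) (n2::nat) (b::nat) (n::nat) (S :: nat set) (s::nat)
      (p1 :: nat list) (p2 :: nat list) (p3 :: nat list) (l::real) (fhat :: 'a \<Rightarrow> nat \<Rightarrow> real).
      branched_path n1 n2 b \<longrightarrow>
      n = n1 + n2 \<longrightarrow>
      gaussian_noise M n \<sigma> eps \<longrightarrow>
      S \<subseteq> {2..n} \<longrightarrow>
      s = card S \<longrightarrow>
      S \<inter> {2..b} \<noteq> {} \<longrightarrow> S \<inter> {b + 1..n1} \<noteq> {} \<longrightarrow> S \<inter> {n1 + 1..n} \<noteq> {} \<longrightarrow>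
      admissible_decomposition n1 n2 b S p1 p2 p3 \<longrightarrow>
      hd (seg_lengths n1 b S p1) \<ge> 4 \<longrightarrow>
      last (seg_lengths n1 b S p2) \<ge> 4 \<longrightarrow>
      last (seg_lengths n1 b S p3) \<ge> 4 \<longrightarrow>
      l = tuning n s \<sigma> \<gamma> \<delta> \<longrightarrow>
      fhat = (\<lambda>\<omega>. tv_estimator n1 n2 b l (\<lambda>i. f0 i + eps i \<omega>)) \<longrightarrow>
      measure M {\<omega> \<in> space M.
          emp_norm_sq n (\<lambda>i. fhat \<omega> i - f0 i)
            \<le> (INF f\<in>extensional {1..n}.
                  emp_norm_sq n (\<lambda>i. f i - f0 i) + 4 * l * norm1 ({2..n} - S) (Dop n1 b f))
              + 8 * ln (2 / \<delta>) * \<sigma>\<^sup>2 / n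
              + 4 * \<sigma>\<^sup>2 * ((real s + 1) / n)
              + 8 * \<sigma>\<^sup>2 * ln (4 * (real n - real s - 1) / \<delta>)
                * (2 * \<gamma>\<^sup>2 * s / harmonic_mean (Delta n1 b S p1 p2 p3)
                   + 5 * (2 * real s + 3) / (2 * real n) * ln ((real n + 1) / (2 * real s + 3))
                   + zeta n1 n2 b S / n)
          \<and> (S = active_set n1 n2 b f0 \<and> n \<ge> N \<longrightarrow>
               emp_norm_sq n (\<lambda>i. fhat \<omega> i - f0 i)
                 \<le> C1 * (ln n * s / harmonic_mean (Delta n1 b S p1 p2 p3))
                   + C2 * (ln n * ln (real n / s) * s / n)
                   + C3 * (ln n * zeta n1 n2 b S / n))}
        \<ge> 1 - \<delta>"
proof -
  define K where "K = ln (4 / \<delta>) + 1"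
  define C1 where "C1 = 16 * \<sigma>\<^sup>2 * \<gamma>\<^sup>2 * K"
  define C2 where "C2 = 8 * ln (2 / \<delta>) * \<sigma>\<^sup>2 + 8 * \<sigma>\<^sup>2 + 60 * \<sigma>\<^sup>2 * K"
  define C3 where "C3 = 8 * \<sigma>\<^sup>2 * K"
  have bound: "measure M {\<omega> \<in> space M.
          emp_norm_sq n (\<lambda>i. fhat \<omega> i - f0 i)
            \<le> (INF f\<in>extensional {1..n}.
                  emp_norm_sq n (\<lambda>i. f i - f0 i) + 4 * l * norm1 ({2..n} - S) (Dop n1 b f))
              + 8 * ln (2 / \<delta>) * \<sigma>\<^sup>2 / n
              + 4 * \<sigma>\<^sup>2 * ((real s + 1) / n)
              + 8 * \<sigma>\<^sup>2 * ln (4 * (real n - real s - 1) / \<delta>)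
                * (2 * \<gamma>\<^sup>2 * s / harmonic_mean (Delta n1 b S p1 p2 p3)
                   + 5 * (2 * real s + 3) / (2 * real n) * ln ((real n + 1) / (2 * real s + 3))
                   + zeta n1 n2 b S / n)
          \<and> (S = active_set n1 n2 b f0 \<and> n \<ge> 0 \<longrightarrow>
               emp_norm_sq n (\<lambda>i. fhat \<omega> i - f0 i)
                 \<le> C1 * (ln n * s / harmonic_mean (Delta n1 b S p1 p2 p3))
                   + C2 * (ln n * ln (real n / s) * s / n)
                   + C3 * (ln n * zeta n1 n2 b S / n))}
        \<ge> 1 - \<delta>"
    if graph: "branched_path n1 n2 b" and n: "n = n1 + n2" and noise: "gaussian_noise M n \<sigma> eps"
      and S: "S \<subseteq> {2..n}" and s: "s = card S"
      and parts: "S \<inter> {2..b} \<noteq> {}" "S \<inter> {b + 1..n1} \<noteq> {}" "S \<inter> {n1 + 1..n} \<noteq> {}"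
      and dec: "admissible_decomposition n1 n2 b S p1 p2 p3"
      and ends: "hd (seg_lengths n1 b S p1) \<ge> 4" "last (seg_lengths n1 b S p2) \<ge> 4"
        "last (seg_lengths n1 b S p3) \<ge> 4"
      and l: "l = tuning n s \<sigma> \<gamma> \<delta>"
      and fhat: "fhat = (\<lambda>\<omega>. tv_estimator n1 n2 b l (\<lambda>i. f0 i + eps i \<omega>))"
    for M :: "'a measure" and eps f0 n1 n2 b n S s p1 p2 p3 l fhat
  proof -
    interpret decomposed_branched_path n1 n2 b n S p1 p2 p3
      using graph n S parts dec by unfold_locales
    interpret prob_space M
      using noise by (simp add: gaussian_noise_def)
    have ind: "indep_vars (\<lambda>_. borel) eps {1..n}"
      and normal: "\<And>i. i \<in> {1..n} \<Longrightarrow> distributed M lborel (eps i) (normal_density 0 \<sigma>)"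
      using noise by (auto simp: gaussian_noise_def)
    define L where "L = ln (4 * (real n - real s - 1) / \<delta>)"
    define z where "z = zeta n1 n2 b S"
    define E where "E = 8 * ln (2 / \<delta>) * \<sigma>\<^sup>2 / real n + 4 * \<sigma>\<^sup>2 * ((real s + 1) / real n)
      + 8 * \<sigma>\<^sup>2 * L * (2 * \<gamma>\<^sup>2 * real s / H
          + 5 * (2 * real s + 3) / (2 * real n) * ln ((real n + 1) / (2 * real s + 3)) + z / real n)"
    define obj where "obj f = emp_norm_sq n (\<lambda>i. f i - f0 i)
      + 4 * l * norm1 ({2..n} - S) (Dop n1 b f)" for f
    define risk where "risk \<omega> = emp_norm_sq n (\<lambda>i. fhat \<omega> i - f0 i)" for \<omega>
    have size: "4 * card S + 6 \<le> n" by (rule vertex_count[OF ends])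
    have sn: "3 \<le> real s" "4 * real s + 6 \<le> real n"
      using size card_S_ge by (auto simp: s)
    have arg: "1 < 4 * (real n - real s - 1) / \<delta>"
      using sn assms by (simp add: less_divide_eq)
    then have L: "0 < L" by (simp add: L_def)
    have l0: "0 \<le> l"
      using assms L by (simp add: l tuning_def L_def)
    have z0: "0 \<le> z" by (simp add: z_def zeta_nonneg)
    have obj0: "0 \<le> obj f" for f
      using l0 by (auto simp: obj_def emp_norm_sq_def norm1_def intro!: add_nonneg_nonneg divide_nonneg_nonneg sum_nonneg)
    have nonempty: "[] \<notin> set segs"
      using seg_length_ge by fastforce
    \<comment> \<open>Both parts of the noise event fail with probability at most \<open>\<delta> / 2\<close>.\<close>
    obtain G where G: "G \<in> events"
      "1 - (2 * (real (length (concat segs)) - real (length segs)) * exp (- L)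
        + exp (- ln (2 / \<delta>))) \<le> prob G"
      "\<And>\<omega> g. \<omega> \<in> G \<Longrightarrow> g \<in> set segs \<Longrightarrow> noise_small (\<sigma> * sqrt (2 * L)) (\<lambda>i. eps i \<omega>) g"
      "\<And>\<omega>. \<omega> \<in> G \<Longrightarrow> (\<Sum>g\<leftarrow>segs. (\<Sum>v\<leftarrow>g. eps v \<omega>)\<^sup>2 / real (length g))
        \<le> \<sigma>\<^sup>2 * (4 * ln (2 / \<delta>) + 2 * ln 2 * real (length segs))"
      using noise_event[OF assms(1) ind normal distinct_concat_segs _ nonempty L, of "ln (2 / \<delta>)"]
        set_concat_segs by blast
    have "1 - \<delta> \<le> prob G"
    proof -
      have "exp (- ln (2 / \<delta>)) = \<delta> / 2"
        using assms by (simp add: exp_minus)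
      moreover have "exp (- L) = \<delta> / (4 * (real n - real s - 1))"
        using arg by (simp add: L_def exp_minus)
      moreover have "2 * (real n - (real s + 3)) * (\<delta> / (4 * (real n - real s - 1))) \<le> \<delta> / 2"
      proof -
        have "(real n - (real s + 3)) * \<delta> \<le> (real n - real s - 1) * \<delta>"
          using assms by (intro mult_right_mono) auto
        then show ?thesis
          using sn by (simp add: divide_simps) (simp add: algebra_simps)
      qed
      ultimately show ?thesis
        using G(2) by (simp add: length_concat_segs length_segs s)
    qed
    have risk_le: "risk \<omega> \<le> obj f + E" if \<omega>: "\<omega> \<in> G" and f: "f \<in> extensional {1..n}" for \<omega> f
    proof -
      have "0 \<le> 8 * \<sigma>\<^sup>2 * L * (z / real n)"
        using L z0 by simp
      moreover have "risk \<omega> \<le> obj f + (8 * ln (2 / \<delta>) * \<sigma>\<^sup>2 / real n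
          + 4 * \<sigma>\<^sup>2 * ((real s + 1) / real n)
          + 8 * \<sigma>\<^sup>2 * L * (2 * \<gamma>\<^sup>2 * real s / H
          + 5 * (2 * real s + 3) / (2 * real n) * ln ((real n + 1) / (2 * real s + 3))))"
        unfolding risk_def obj_def fhat l L_def s
        by (rule tv_oracle_inequality[OF assms size _ _ f])
           (use G(3,4)[OF \<omega>] in \<open>auto simp: L_def s\<close>)
      ultimately show ?thesis
        by (simp add: E_def distrib_left)
    qed
    have inf: "risk \<omega> \<le> (INF f\<in>extensional {1..n}. obj f) + E" if "\<omega> \<in> G" for \<omega>
    proof -
      have "extensional {1..n} \<noteq> ({} :: (nat \<Rightarrow> real) set)"
        by (metis empty_iff restrict_extensional)
      then have "risk \<omega> - E \<le> (INF f\<in>extensional {1..n}. obj f)"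
        using risk_le[OF that] by (intro cINF_greatest) (auto simp: algebra_simps)
      then show ?thesis by simp
    qed
    have rate: "risk \<omega> \<le> C1 * (ln n * s / H) + C2 * (ln n * ln (real n / s) * s / n)
        + C3 * (ln n * z / n)" if \<omega>: "\<omega> \<in> G" and act: "S = active_set n1 n2 b f0" for \<omega>
    proof -
      \<comment> \<open>The infimum runs over extensional vectors only.\<close>
      have "obj (restrict f0 {1..n}) = 0"
      proof -
        have "Dop n1 b (restrict f0 {1..n}) i = 0" if i: "i \<in> {2..n} - S" for i
          using i act parent_less[OF graph, of i] by (auto simp: Dop_def active_set_def n)
        then show ?thesis
          by (simp add: obj_def emp_norm_sq_def norm1_def)
      qed
      then have "risk \<omega> \<le> E"
        using risk_le[OF \<omega>, of "restrict f0 {1..n}"] by simp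
      also have "E \<le> C1 * (ln (real n) * (real s / H))
          + C2 * (ln (real n) * ln (real n / real s) * real s / real n) + C3 * (ln (real n) * z / real n)"
      proof -
        have "0 \<le> cost" by (intro sum_list_nonneg) auto
        then have "0 \<le> real s / H"
          using harmonic_mean_Delta by (simp add: s)
        then show ?thesis
          using rate_le[OF assms(3,4) sn _ z0, of "real s / H" \<sigma> \<gamma>]
          by (simp add: E_def L_def C1_def C2_def C3_def K_def)
      qed
      finally show ?thesis by simp
    qed
    define good where "good = {\<omega> \<in> space M. risk \<omega> \<le> (INF f\<in>extensional {1..n}. obj f) + E
      \<and> (S = active_set n1 n2 b f0 \<longrightarrow> risk \<omega> \<le> C1 * (ln n * s / H)
        + C2 * (ln n * ln (real n / s) * s / n) + C3 * (ln n * z / n))}"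
    have "risk \<in> borel_measurable M"
      unfolding risk_def[abs_def] fhat n
    proof (rule tv_risk_measurable[OF graph l0])
      fix i assume "i \<in> {1..n1 + n2}"
      then show "eps i \<in> borel_measurable M"
        using distributed_measurable[OF normal] n by auto
    qed
    then have "good \<in> events"
      unfolding good_def by measurable
    moreover have "G \<subseteq> good"
      using sets.sets_into_space[OF G(1)] inf rate by (auto simp: good_def)
    ultimately have "1 - \<delta> \<le> prob good"
      using finite_measure_mono[of G good] \<open>1 - \<delta> \<le> prob G\<close> by simp
    then show ?thesis
      by (simp add: good_def risk_def obj_def E_def z_def L_def add.assoc)
  qed
  \<comment> \<open>The rates hold for every admissible \<open>n\<close>, hence the threshold \<open>0\<close>.\<close>
  show ?thesis
    by (intro exI[of _ C1] exI[of _ C2] exI[of _ C3] exI[of _ "0::nat"] allI impI, rule bound)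
qed

end
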